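(* Let $U_0>0$, $V_0>0$ (case $\varepsilon=0$). Then there exists a unique solution $f$, with associated free-boundary position $a>0$, of the problem $$\begin{aligned} &-\tfrac12\eta f'(\eta)=[\phi'(f(\eta))f'(\eta)]' &&\text{if }\eta<a,\\ &f(\eta)=-V_0 &&\text{if }\eta>a,\\ &\lim_{\eta\to-\infty}f(\eta)=U_0,\qquad \lim_{\eta\nearrow a}f(\eta)=0,\\ &\lim_{\eta\nearrow a}\phi'(f(\eta))f'(\eta)=-\frac{aV_0}{2}, \end{aligned}$$ where a prime on $f$ or on a bracket denotes differentiation with respect to $\eta$.
   Context: $\phi\in C^2(\mathbb{R})$ is such that $\phi$ and $\phi'$ are strictly increasing on $[0,\infty)$, $\phi(s)>0$ for $s>0$, $\phi(0)=\phi'(0)=0$, and $\int_0^1\frac{\phi'(s)}{s}\,ds<\infty$, $\int_1^\infty\frac{\phi'(s)}{s}\,ds=\infty$. The constant $a>0$ is part of the unknown. A solution is a function $f:\mathbb{R}\setminus\{a\}\to\mathbb{R}$ together with $a>0$ such that $f$ is positive and $C^2$ on $(-\infty,a)$, and all the relations hold. *)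

theory Defs
  imports "HOL-Analysis.Analysis"
begin

text \<open>Intended for open \<open>S\<close>, where the two-sided derivative at each point is the right notion.\<close>

definition C2_on :: "real set \<Rightarrow> (real \<Rightarrow> real) \<Rightarrow> bool" where
  "C2_on S f \<longleftrightarrow>
     (\<forall>x\<in>S. f differentiable (at x)) \<and>
     (\<forall>x\<in>S. deriv f differentiable (at x)) \<and>
     continuous_on S (deriv (deriv f))"

text \<open>
  On \<open>[0,\<infinity>)\<close> the derivative of \<open>\<phi>\<close> is nonnegative, so the two integrals, which are improper
  at \<open>0\<close> and at \<open>\<infinity>\<close>, are integrals of nonnegative functions with values in \<open>[0,\<infinity>]\<close>.
\<close>

definition admissible_phi :: "(real \<Rightarrow> real) \<Rightarrow> bool" where
  "admissible_phi \<phi> \<longleftrightarrow>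
     C2_on UNIV \<phi> \<and>
     strict_mono_on {0..} \<phi> \<and>
     strict_mono_on {0..} (deriv \<phi>) \<and>
     (\<forall>s>0. \<phi> s > 0) \<and>
     \<phi> 0 = 0 \<and> deriv \<phi> 0 = 0 \<and>
     (\<integral>\<^sup>+s\<in>{0<..1}. ennreal (deriv \<phi> s / s) \<partial>lborel) < \<infinity> \<and>
     (\<integral>\<^sup>+s\<in>{1..}. ennreal (deriv \<phi> s / s) \<partial>lborel) = \<infinity>"

text \<open>
  The unknown is a pair \<open>(f, a)\<close> with \<open>f\<close> a function on \<open>\<real> - {a}\<close>. As usual for partial functions,
  \<open>extensional\<close> fixes the irrelevant value at \<open>a\<close>, so that equality of the HOL
  functions is equality on \<open>\<real> - {a}\<close>; none of the other conditions depends on that value.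
\<close>

definition free_boundary_solution ::
    "(real \<Rightarrow> real) \<Rightarrow> real \<Rightarrow> real \<Rightarrow> (real \<Rightarrow> real) \<Rightarrow> real \<Rightarrow> bool" where
  "free_boundary_solution \<phi> U\<^sub>0 V\<^sub>0 f a \<longleftrightarrow>
     a > 0 \<and>
     f \<in> extensional (UNIV - {a}) \<and>
     C2_on {..<a} f \<and>
     (\<forall>\<eta><a. f \<eta> > 0) \<and>
     (\<forall>\<eta><a. - (1/2) * \<eta> * deriv f \<eta> = deriv (\<lambda>x. deriv \<phi> (f x) * deriv f x) \<eta>) \<and>
     (\<forall>\<eta>>a. f \<eta> = - V\<^sub>0) \<and>
     (f \<longlongrightarrow> U\<^sub>0) at_bot \<and>
     (f \<longlongrightarrow> 0) (at_left a) \<and>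
     ((\<lambda>\<eta>. deriv \<phi> (f \<eta>) * deriv f \<eta>) \<longlongrightarrow> - (a * V\<^sub>0 / 2)) (at_left a)"

end

theory Submission
  imports Defs
begin

text \<open>
  A solution \<open>f\<close> is strictly decreasing on \<open>(-\<infinity>, a)\<close>, so \<open>u = f \<eta>\<close> can serve as independent
  variable (hodograph transformation). For the flux \<open>q u = - \<phi>' (f \<eta>) f' \<eta>\<close> the equation becomes
  \<open>q' = \<eta> / 2\<close> and \<open>q q'' = - \<phi>' / 2\<close> on \<open>(0, U)\<close>, and the free boundary conditions become
  \<open>q 0 = V q' 0\<close>, \<open>q U = 0\<close>, with \<open>a = 2 q' 0\<close>. Uniqueness is the maximum principle: where
  \<open>q\<^sub>1 > q\<^sub>2\<close>, the difference \<open>q\<^sub>1 - q\<^sub>2\<close> is strictly convex.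

  For existence, replace the condition at \<open>U\<close> by \<open>q U = e > 0\<close>. The solution operator \<open>S\<close> of
  \<open>v'' = - \<phi>' / (2 y)\<close> is order reversing, so iterating \<open>S \<circ> S\<close> from the
  affine function gives a monotone sequence whose limit yields \<open>P = S R\<close>, \<open>R = S P\<close>. Then
  \<open>R'' P = P'' R\<close>, so the Wronskian of \<open>P\<close> and \<open>R\<close> is constant and the boundary conditions force \<open>P = R\<close>.
  The profiles decrease with \<open>e\<close> and are bounded below on compact subsets of \<open>[0, U)\<close>, so one can let
  \<open>e \<rightarrow> 0\<close>.
\<close>

text \<open>A Lipschitz bound uniform in \<open>n\<close> survives pointwise limits, which spares
  any argument for uniform convergence of the approximations below.\<close>

lemma continuous_on_lipschitz_limit:
  fixes f :: "nat \<Rightarrow> real \<Rightarrow> real"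
  assumes "\<And>n x y. x \<in> S \<Longrightarrow> y \<in> S \<Longrightarrow> \<bar>f n x - f n y\<bar> \<le> L * \<bar>x - y\<bar>"
    and "\<And>x. x \<in> S \<Longrightarrow> (\<lambda>n. f n x) \<longlonglongrightarrow> g x"
  shows "continuous_on S g"
proof -
  have *: "\<bar>g x - g y\<bar> \<le> L * \<bar>x - y\<bar>" if "x \<in> S" "y \<in> S" for x y
  proof (rule Lim_bounded)
    show "(\<lambda>n. \<bar>f n x - f n y\<bar>) \<longlonglongrightarrow> \<bar>g x - g y\<bar>" by (intro tendsto_intros assms that)
  qed (use assms that in auto)
  \<comment> \<open>\<open>lipschitz_onI\<close> wants a nonnegative constant, and nothing is
    assumed about the sign of \<open>L\<close>.\<close>
  have "(max L 0)-lipschitz_on S g"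
  proof (rule lipschitz_onI)
    fix x y assume "x \<in> S" "y \<in> S"
    then have "\<bar>g x - g y\<bar> \<le> L * \<bar>x - y\<bar>" by (rule *)
    also have "\<dots> \<le> max L 0 * \<bar>x - y\<bar>" by (intro mult_right_mono) auto
    finally show "dist (g x) (g y) \<le> max L 0 * dist x y" by (simp add: dist_real_def)
  qed simp
  then show ?thesis by (rule lipschitz_on_continuous_on)
qed

subsection \<open>The flux as a function of the solution\<close>

text \<open>\<open>D\<close> stands for \<open>deriv \<phi>\<close> on [0, U]. It may vanish at 0,
  where the diffusion degenerates, but nowhere else.\<close>

locale flux_problem =
  fixes D :: "real \<Rightarrow> real" and U V :: real
  assumes U_pos: "U > 0" and V_pos: "V > 0"
    and D_cont: "continuous_on {0..U} D"
    and D_nonneg: "\<And>u. 0 \<le> u \<Longrightarrow> u \<le> U \<Longrightarrow> D u \<ge> 0"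
    and D_pos: "\<And>u. 0 < u \<Longrightarrow> u \<le> U \<Longrightarrow> D u > 0"
begin

text \<open>The second-order equation as a first-order system, with \<open>p\<close> in the role of
  half the position. Continuity of \<open>p\<close> at 0 gives the Robin condition its meaning; at
  \<open>U\<close> nothing is asked of \<open>p\<close>, since it tends to minus infinity when
  \<open>e = 0\<close>.\<close>

definition profile :: "real \<Rightarrow> (real \<Rightarrow> real) \<Rightarrow> (real \<Rightarrow> real) \<Rightarrow> bool" where
  "profile e q p \<longleftrightarrow>
     continuous_on {0..U} q \<and> continuous_on {0..<U} p \<and>
     (\<forall>u\<in>{0..<U}. q u > 0) \<and>
     (\<forall>u\<in>{0<..<U}. (q has_real_derivative p u) (at u)) \<and>
     (\<forall>u\<in>{0<..<U}. (p has_real_derivative - D u / (2 * q u)) (at u)) \<and>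
     q 0 = V * p 0 \<and> q U = e"

text \<open>Suppose \<open>q1 - q2\<close> has a positive maximum at \<open>m\<close>. Then
  \<open>m < U\<close>, the slope at \<open>m\<close> is nonnegative, and strict convexity to the
  right of \<open>m\<close> makes the difference exceed its maximum.\<close>

lemma profile_mono:
  assumes 1: "profile e1 q1 p1" and 2: "profile e2 q2 p2" and "e1 \<le> e2"
    and u: "u \<in> {0..U}"
  shows "q1 u \<le> q2 u"
proof -
  define d where "d = (\<lambda>u. q1 u - q2 u)"
  define g where "g = (\<lambda>u. p1 u - p2 u)"
  have d_cont: "continuous_on {0..U} d"
    using 1 2 unfolding d_def profile_def by (intro continuous_intros) auto
  have g_cont: "continuous_on {0..<U} g"
    using 1 2 unfolding g_def profile_def by (intro continuous_intros) auto
  have d_deriv: "(d has_real_derivative g u) (at u)" if "u \<in> {0<..<U}" for u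
    using 1 2 that unfolding d_def g_def profile_def by (auto intro!: derivative_intros)
  have g_deriv: "(g has_real_derivative (D u / (2 * q2 u) - D u / (2 * q1 u))) (at u)"
    if "u \<in> {0<..<U}" for u
  proof -
    have "(g has_real_derivative (- D u / (2 * q1 u) - (- D u / (2 * q2 u)))) (at u)"
      using 1 2 that unfolding g_def profile_def by (intro derivative_intros) auto
    then show ?thesis by simp
  qed
  obtain m where m: "m \<in> {0..U}" and m_max: "\<And>u. u \<in> {0..U} \<Longrightarrow> d u \<le> d m"
    using continuous_attains_sup[of "{0..U}" d] d_cont U_pos by auto
  have "d m \<le> 0"
  proof (rule ccontr)
    assume "\<not> d m \<le> 0"
    then have dm: "d m > 0" by simp
    have "d U \<le> 0" using 1 2 assms(3) by (simp add: d_def profile_def)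
    then have mU: "m < U" using m dm by (cases "m = U") auto
    \<comment> \<open>Within distance \<open>r\<close> of \<open>m\<close> the difference varies by
      less than \<open>d m\<close>, so it stays positive there.\<close>
    obtain r where r: "r > 0" and rd: "\<And>x. x \<in> {0..U} \<Longrightarrow> dist x m < r \<Longrightarrow> dist (d x) (d m) < d m"
      using d_cont m dm unfolding continuous_on_iff by blast
    define b where "b = m + min (r/2) ((U - m)/2)"
    have b: "m < b" "b < U" "b - m < r"
      using r mU by (auto simp: b_def min_def field_simps)
    have dpos: "d x > 0" if "x \<in> {m..b}" for x
      using rd[of x] that b m by (auto simp: dist_real_def)
    \<comment> \<open>At an interior maximum the slope is zero; at \<open>m = 0\<close> the Robin
      condition gives \<open>g 0 = d 0 / V > 0\<close>.\<close>
    have g_m: "g m \<ge> 0"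
    proof (cases "m = 0")
      case True
      have "d 0 = V * g 0" using 1 2 by (simp add: d_def g_def profile_def algebra_simps)
      then show ?thesis using dm V_pos True by (simp add: zero_less_mult_iff)
    next
      case False
      then have m': "0 < m" using m by auto
      have "g m = 0"
      proof (rule DERIV_local_max[OF d_deriv])
        show "m \<in> {0<..<U}" using m' mU by auto
        show "0 < min m (U - m)" using m' mU by auto
        show "\<forall>y. \<bar>m - y\<bar> < min m (U - m) \<longrightarrow> d y \<le> d m"
          using m_max by (auto simp: abs_if split: if_splits)
      qed
      then show ?thesis by simp
    qed
    have g_pos: "g x > 0" if x: "x \<in> {m<..b}" for x
    proof -
      have "g m < g x"
      proof (rule DERIV_pos_imp_increasing_open[of m x g])
        show "m < x" using x by simp
        show "continuous_on {m..x} g"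
          by (rule continuous_on_subset[OF g_cont]) (use x b m in auto)
        fix y assume y: "m < y" "y < x"
        then have yI: "y \<in> {0<..<U}" using x b m by auto
        have "q2 y < q1 y" using dpos[of y] y x by (auto simp: d_def)
        moreover have "q2 y > 0" using 2 yI by (auto simp: profile_def)
        moreover have "D y > 0" using D_pos yI by auto
        ultimately have "D y / (2 * q2 y) - D y / (2 * q1 y) > 0"
          by (simp add: divide_strict_left_mono)
        with g_deriv[OF yI] show "\<exists>z. (g has_real_derivative z) (at y) \<and> 0 < z" by blast
      qed
      with g_m show ?thesis by simp
    qed
    have "d m < d b"
    proof (rule DERIV_pos_imp_increasing_open[of m b d])
      show "continuous_on {m..b} d"
        by (rule continuous_on_subset[OF d_cont]) (use b m in auto)
      fix y assume y: "m < y" "y < b"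
      then show "\<exists>z. (d has_real_derivative z) (at y) \<and> 0 < z"
        using d_deriv[of y] g_pos[of y] b m by auto
    qed (use b in auto)
    with m_max[of b] b m show False by auto
  qed
  with m_max[OF u] show ?thesis by (simp add: d_def)
qed

text \<open>Comparison in both directions settles \<open>q\<close>. Then \<open>p\<close> is
  determined as its derivative inside and by \<open>q 0 = V * p 0\<close> at 0.\<close>

lemma profile_unique:
  assumes 1: "profile e q1 p1" and 2: "profile e q2 p2"
  shows "u \<in> {0..U} \<Longrightarrow> q1 u = q2 u" and "u \<in> {0..<U} \<Longrightarrow> p1 u = p2 u"
proof -
  have eq: "q1 u = q2 u" if "u \<in> {0..U}" for u
    using profile_mono[OF 1 2 _ that] profile_mono[OF 2 1 _ that] by simp
  then show "u \<in> {0..U} \<Longrightarrow> q1 u = q2 u" .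
  assume u: "u \<in> {0..<U}"
  show "p1 u = p2 u"
  proof (cases "u = 0")
    case True
    then show ?thesis using 1 2 eq[of 0] V_pos U_pos by (simp add: profile_def)
  next
    case False
    then have u': "u \<in> {0<..<U}" using u by auto
    have d2: "(q2 has_real_derivative p2 u) (at u)" using 2 u' by (simp add: profile_def)
    have "(q1 has_real_derivative p2 u) (at u)"
      by (rule has_field_derivative_transform_within_open[OF d2, of "{0<..<U}"])
        (use u' eq in auto)
    moreover have "(q1 has_real_derivative p1 u) (at u)" using 1 u' by (simp add: profile_def)
    ultimately show ?thesis by (rule DERIV_unique[rotated])
  qed
qed

subsection \<open>The order-reversing solution operator\<close>

text \<open>The second antiderivative of \<open>h\<close> with value and slope zero at 0, as a
  single integral by Cauchy's formula.\<close>

definition vol :: "(real \<Rightarrow> real) \<Rightarrow> real \<Rightarrow> real" where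
  "vol h u = integral {0..u} (\<lambda>s. (u - s) * h s)"

text \<open>For continuous \<open>h\<close>, the solution of v'' = -h with v(0) = V v'(0) and v(U) =
  e. A multiple of u + V respects the condition at 0, and its coefficient, the slope at 0, is fixed
  by the value at \<open>U\<close>.\<close>

definition green :: "real \<Rightarrow> (real \<Rightarrow> real) \<Rightarrow> real \<Rightarrow> real" where
  "green e h u = (e + vol h U) / (U + V) * (u + V) - vol h u"

definition src :: "(real \<Rightarrow> real) \<Rightarrow> real \<Rightarrow> real" where
  "src y s = D s / (2 * y s)"

text \<open>Splitting \<open>u - s\<close> removes the variable from the integrands; the boundary
  terms \<open>u * h u\<close> then cancel.\<close>

lemma vol_deriv:
  assumes h: "continuous_on {0..b} h" and u: "u \<in> {0..b}"
  shows "(vol h has_real_derivative integral {0..u} h) (at u within {0..b})"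
proof -
  have h': "continuous_on {0..b} (\<lambda>s. s * h s)" using h by (intro continuous_intros)
  have eq: "vol h x = x * integral {0..x} h - integral {0..x} (\<lambda>s. s * h s)" if "x \<in> {0..b}" for x
  proof -
    have "{0..x} \<subseteq> {0..b}" using that by auto
    then have "h integrable_on {0..x}" "(\<lambda>s. s * h s) integrable_on {0..x}"
      using h h' by (auto intro!: integrable_continuous_real elim: continuous_on_subset)
    then show ?thesis
      by (simp add: vol_def left_diff_distrib integral_diff[OF integrable_on_mult_right])
  qed
  have "((\<lambda>x. x * integral {0..x} h - integral {0..x} (\<lambda>s. s * h s)) has_real_derivative
      (1 * integral {0..u} h + h u * u - u * h u)) (at u within {0..b})"
    by (intro DERIV_diff DERIV_mult DERIV_ident integral_has_real_derivative[OF h u]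
        integral_has_real_derivative[OF h' u])
  then have "((\<lambda>x. x * integral {0..x} h - integral {0..x} (\<lambda>s. s * h s)) has_real_derivative
      integral {0..u} h) (at u within {0..b})" by simp
  then show ?thesis
    by (rule has_field_derivative_transform_within[of _ _ _ _ 1]) (use u eq in auto)
qed

text \<open>The coefficient \<open>A\<close> and the endpoint \<open>b\<close> are free because this
  serves both \<open>green\<close> on [0, U] and the limit profile on [0, b] with b < U.\<close>

lemma affine_minus_vol_deriv:
  assumes h: "continuous_on {0..b} h" and u: "u \<in> {0..b}"
  shows "((\<lambda>u. A * (u + V) - vol h u) has_real_derivative (A - integral {0..u} h))
    (at u within {0..b})"
proof -
  have "((\<lambda>u. A * (u + V) - vol h u) has_real_derivative (A * (1 + 0) - integral {0..u} h))
    (at u within {0..b})"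
    by (intro DERIV_diff DERIV_cmult DERIV_add DERIV_ident DERIV_const vol_deriv[OF h u])
  then show ?thesis by simp
qed

lemma green_deriv:
  assumes h: "continuous_on {0..U} h" and u: "u \<in> {0..U}"
  shows "(green e h has_real_derivative ((e + vol h U) / (U + V) - integral {0..u} h))
    (at u within {0..U})"
  unfolding green_def by (rule affine_minus_vol_deriv[OF h u])

lemma vol_0 [simp]: "vol h 0 = 0"
  by (simp add: vol_def)

lemma green_U [simp]: "green e h U = e"
  using U_pos V_pos by (simp add: green_def)

lemma green_0: "green e h 0 = V * ((e + vol h U) / (U + V))"
  by (simp add: green_def)

section \<open>Green's function of -v'' with v(0) = V v'(0) and v(U) = 0, and the comparison
  principle\<close>

definition ker :: "real \<Rightarrow> real \<Rightarrow> real" where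
  "ker u s = (u + V) * (U - s) / (U + V) - max 0 (u - s)"

lemma ker_alt: "s \<le> u \<Longrightarrow> ker u s = (U - u) * (s + V) / (U + V)"
  using U_pos V_pos by (simp add: ker_def field_simps)

lemma ker_nonneg: "u \<in> {0..U} \<Longrightarrow> s \<in> {0..U} \<Longrightarrow> ker u s \<ge> 0"
  using ker_alt[of s u] U_pos V_pos by (cases "s \<le> u") (auto simp: ker_def)

lemma ker_pos: "u \<in> {0..<U} \<Longrightarrow> s \<in> {0..<U} \<Longrightarrow> ker u s > 0"
  using ker_alt[of s u] U_pos V_pos by (cases "s \<le> u") (auto simp: ker_def)

lemma ker_cont: "continuous_on S (ker u)"
  using U_pos V_pos unfolding ker_def by (intro continuous_intros) auto

text \<open>The positive part \<open>max 0 (u - s)\<close> extends the integral in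
  \<open>vol h u\<close> to all of [0, U], so both occurrences of \<open>vol\<close> merge into one
  integral against a nonnegative kernel.\<close>

lemma green_ker:
  assumes h: "continuous_on {0..U} h" and u: "u \<in> {0..U}"
  shows "green e h u = e * (u + V) / (U + V) + integral {0..U} (\<lambda>s. ker u s * h s)"
proof -
  have i1: "(\<lambda>s. (u + V) / (U + V) * ((U - s) * h s)) integrable_on {0..U}"
    using h by (intro integrable_continuous_real continuous_intros)
  have i2: "(\<lambda>s. max 0 (u - s) * h s) integrable_on {0..U}"
    using h by (intro integrable_continuous_real continuous_intros)
  have "integral {0..U} (\<lambda>s. max 0 (u - s) * h s)
      = integral {0..u} (\<lambda>s. max 0 (u - s) * h s) + integral {u..U} (\<lambda>s. max 0 (u - s) * h s)"
    by (rule Henstock_Kurzweil_Integration.integral_combine[symmetric, OF _ _ i2]) (use u in auto)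
  also have "integral {0..u} (\<lambda>s. max 0 (u - s) * h s) = vol h u"
    unfolding vol_def by (rule integral_cong) auto
  also have "integral {u..U} (\<lambda>s. max 0 (u - s) * h s) = integral {u..U} (\<lambda>s. 0)"
    by (rule integral_cong) auto
  finally have *: "integral {0..U} (\<lambda>s. max 0 (u - s) * h s) = vol h u" by simp
  have "(\<lambda>s. ker u s * h s) = (\<lambda>s. (u + V) / (U + V) * ((U - s) * h s) - max 0 (u - s) * h s)"
    by (simp add: ker_def fun_eq_iff left_diff_distrib)
  then have "integral {0..U} (\<lambda>s. ker u s * h s) = (u + V) / (U + V) * vol h U - vol h u"
    using integral_diff[OF i1 i2] * by (simp add: vol_def)
  then show ?thesis by (simp add: green_def add_divide_distrib algebra_simps)
qed

text \<open>In the form of \<open>green_ker\<close>, both \<open>e\<close> and the source carry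
  nonnegative weights.\<close>

lemma green_mono:
  assumes h: "continuous_on {0..U} h" "continuous_on {0..U} k" and u: "u \<in> {0..U}"
    and le: "\<And>s. s \<in> {0..U} \<Longrightarrow> h s \<le> k s" and e: "e \<le> e'"
  shows "green e h u \<le> green e' k u"
proof -
  have "integral {0..U} (\<lambda>s. ker u s * h s) \<le> integral {0..U} (\<lambda>s. ker u s * k s)"
    using h le ker_nonneg[OF u]
    by (intro integral_le integrable_continuous_real continuous_intros ker_cont mult_left_mono) auto
  moreover have "e * (u + V) / (U + V) \<le> e' * (u + V) / (U + V)"
    using e u U_pos V_pos by (intro divide_right_mono mult_right_mono) auto
  ultimately show ?thesis using green_ker h u by simp
qed

section \<open>The nonlinear source term: order reversal, bounds and limits\<close>

lemma src_cont:
  assumes "continuous_on {0..b} y" and "\<And>s. s \<in> {0..b} \<Longrightarrow> y s > 0" and "b \<le> U"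
  shows "continuous_on {0..b} (src y)"
proof -
  have "continuous_on {0..b} D" using D_cont by (rule continuous_on_subset) (use assms in auto)
  then show ?thesis using assms unfolding src_def
    by (intro continuous_intros) (auto simp: less_le)
qed

lemma src_antimono:
  assumes "0 < y s" "y s \<le> z s" "s \<in> {0..U}"
  shows "src z s \<le> src y s"
  using assms D_nonneg[of s] unfolding src_def by (intro divide_left_mono) auto

lemma src_nonneg: "0 < y s \<Longrightarrow> s \<in> {0..U} \<Longrightarrow> 0 \<le> src y s"
  using D_nonneg[of s] unfolding src_def by auto

definition D_max :: real where "D_max = (SUP s\<in>{0..U}. D s)"

lemma D_le_max: "s \<in> {0..U} \<Longrightarrow> D s \<le> D_max"
  unfolding D_max_def
  by (intro cSUP_upper bounded_imp_bdd_above compact_imp_bounded compact_continuous_image D_cont) auto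

lemma src_le:
  assumes "0 < c" "c \<le> y s" "s \<in> {0..U}"
  shows "src y s \<le> D_max / (2 * c)"
  unfolding src_def using assms D_le_max[of s] D_nonneg[of s] by (intro frac_le) auto

text \<open>The lower bound \<open>c\<close> keeps the sources below \<open>D_max / (2 * c)\<close>,
  so dominated convergence applies. It is used with \<open>b = U\<close> for fixed e > 0 and with
  \<open>b < U\<close> in the limit e to 0.\<close>

lemma vol_src_limit:
  assumes b: "b \<le> U" and c: "c > 0"
    and y: "\<And>n. continuous_on {0..b} (y n)" "\<And>n s. s \<in> {0..b} \<Longrightarrow> c \<le> y n s"
    and lim: "\<And>s. s \<in> {0..b} \<Longrightarrow> (\<lambda>n. y n s) \<longlonglongrightarrow> z s"
    and u: "u \<in> {0..b}"
  shows "(\<lambda>n. vol (src (y n)) u) \<longlonglongrightarrow> vol (src z) u"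
  unfolding vol_def
proof (rule dominated_convergence(2))
  fix n
  have sub: "{0..u} \<subseteq> {0..b}" using u by auto
  have "continuous_on {0..b} (src (y n))"
    by (rule src_cont[OF y(1) _ b]) (use c y(2) in \<open>auto intro: less_le_trans\<close>)
  then show "(\<lambda>s. (u - s) * src (y n) s) integrable_on {0..u}"
    using sub by (intro integrable_continuous_real continuous_intros) (auto elim: continuous_on_subset)
  show "(\<lambda>s. u * (D_max / (2 * c))) integrable_on {0..u}"
    by (intro integrable_continuous_real continuous_on_const)
  fix s assume s: "s \<in> {0..u}"
  then have s': "s \<in> {0..b}" "s \<in> {0..U}" using u b by auto
  have "0 < y n s" using c y(2)[OF s'(1), of n] by simp
  then have "0 \<le> src (y n) s" using s' by (intro src_nonneg)
  moreover have "src (y n) s \<le> D_max / (2 * c)" using c y(2) s' by (intro src_le) auto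
  ultimately have "0 \<le> (u - s) * src (y n) s" "(u - s) * src (y n) s \<le> u * (D_max / (2 * c))"
    using s by (intro mult_nonneg_nonneg mult_mono; simp)+
  then show "norm ((u - s) * src (y n) s) \<le> u * (D_max / (2 * c))" by simp
next
  fix s assume s: "s \<in> {0..u}"
  then have s': "s \<in> {0..b}" "s \<in> {0..U}" using u b by auto
  have "c \<le> z s" by (rule Lim_bounded2[OF lim[OF s'(1)], of 0]) (use y(2) s' in auto)
  then show "(\<lambda>n. (u - s) * src (y n) s) \<longlonglongrightarrow> (u - s) * src z s"
    unfolding src_def using c by (intro tendsto_intros lim s') auto
qed

lemma integral_src_le:
  assumes "0 < c" "u \<in> {0..b}" "b \<le> U"
    and y: "continuous_on {0..b} y" "\<And>s. s \<in> {0..b} \<Longrightarrow> c \<le> y s"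
  shows "0 \<le> integral {0..u} (src y)" and "integral {0..u} (src y) \<le> U * (D_max / (2 * c))"
proof -
  have pos: "0 < y s" if "s \<in> {0..b}" for s using y(2)[OF that] assms(1) by simp
  have "continuous_on {0..u} (src y)"
    by (rule continuous_on_subset[OF src_cont[OF y(1) pos assms(3)]]) (use assms(2) in auto)
  then have int: "src y integrable_on {0..u}" by (rule integrable_continuous_real)
  show "0 \<le> integral {0..u} (src y)"
    using assms pos by (intro integral_nonneg int src_nonneg) auto
  have "integral {0..u} (src y) \<le> integral {0..u} (\<lambda>s. D_max / (2 * c))"
    using assms by (intro integral_le int src_le integrable_continuous_real continuous_on_const) auto
  also have "\<dots> = u * (D_max / (2 * c))" using assms by simp
  also have "\<dots> \<le> U * (D_max / (2 * c))"
  proof (rule mult_right_mono)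
    have "0 \<le> D_max" using D_le_max[of 0] D_nonneg[of 0] U_pos by simp
    then show "0 \<le> D_max / (2 * c)" using assms by simp
  qed (use assms in auto)
  finally show "integral {0..u} (src y) \<le> U * (D_max / (2 * c))" .
qed

text \<open>The derivative is the slope at 0 minus an integral of the source, and
  \<open>integral_src_le\<close> bounds the latter.\<close>

lemma green_src_lipschitz:
  assumes c: "0 < c" and y: "continuous_on {0..U} y" "\<And>s. s \<in> {0..U} \<Longrightarrow> c \<le> y s"
    and u: "u \<in> {0..U}" "v \<in> {0..U}"
  shows "\<bar>green e (src y) u - green e (src y) v\<bar>
    \<le> (\<bar>(e + vol (src y) U) / (U + V)\<bar> + U * (D_max / (2 * c))) * \<bar>u - v\<bar>"
proof -
  have "continuous_on {0..U} (src y)"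
    by (rule src_cont[OF y(1)]) (use c y(2) in \<open>auto intro: less_le_trans\<close>)
  then have d: "(green e (src y) has_real_derivative
      ((e + vol (src y) U) / (U + V) - integral {0..z} (src y))) (at z within {0..U})"
    if "z \<in> {0..U}" for z using that by (rule green_deriv)
  have "norm (green e (src y) u - green e (src y) v)
    \<le> (\<bar>(e + vol (src y) U) / (U + V)\<bar> + U * (D_max / (2 * c))) * norm (u - v)"
  proof (rule field_differentiable_bound[OF _ d _ u])
    fix z assume z: "z \<in> {0..U}"
    then have "\<bar>integral {0..z} (src y)\<bar> \<le> U * (D_max / (2 * c))"
      using integral_src_le[OF c z order_refl y] by simp
    then show "norm ((e + vol (src y) U) / (U + V) - integral {0..z} (src y))
      \<le> \<bar>(e + vol (src y) U) / (U + V)\<bar> + U * (D_max / (2 * c))"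
      using abs_triangle_ineq4[of "(e + vol (src y) U) / (U + V)" "integral {0..z} (src y)"]
      unfolding real_norm_def by linarith
  qed auto
  then show ?thesis by simp
qed

text \<open>The integral identity is kept in the conclusion because the passage to
  \<open>e = 0\<close> compares and converges through it.\<close>

lemma ex_profile_pos:
  assumes e: "e > 0"
  shows "\<exists>q p. profile e q p \<and> (\<forall>u\<in>{0..U}. q u = green e (src q) u)"
proof -
  define S where "S = (\<lambda>y. green e (src y))"
  \<comment> \<open>The affine solution with zero source; \<open>c\<close> is its minimum on [0, U],
    attained at 0.\<close>
  define q0 where "q0 = (\<lambda>u. e * (u + V) / (U + V))"
  define c where "c = e * V / (U + V)"
  have c: "c > 0" using e U_pos V_pos by (simp add: c_def)
  have q0_ge: "c \<le> q0 u" if "u \<in> {0..U}" for u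
    using that e U_pos V_pos unfolding c_def q0_def by (intro divide_right_mono) auto
  \<comment> \<open>Functions above \<open>q0\<close> stay above \<open>c\<close>, away from the
    singularity of \<open>1 / y\<close>, and \<open>S\<close> preserves this class.\<close>
  define good where "good = (\<lambda>y. continuous_on {0..U} y \<and> (\<forall>u\<in>{0..U}. q0 u \<le> y u))"
  have good_c: "c \<le> y u" if "good y" "u \<in> {0..U}" for y u
    using that q0_ge[of u] by (force simp: good_def)
  have good_cont: "continuous_on {0..U} y" if "good y" for y using that by (simp add: good_def)
  have good_src: "continuous_on {0..U} (src y)" if "good y" for y
    by (rule src_cont[OF good_cont[OF that]]) (use good_c[OF that] c in \<open>auto intro: less_le_trans\<close>)
  have good_q0: "good q0" using U_pos V_pos by (auto simp: good_def q0_def intro!: continuous_intros)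
  have S_anti: "S z u \<le> S y u" if "good y" "good z" "\<And>s. s \<in> {0..U} \<Longrightarrow> y s \<le> z s" "u \<in> {0..U}" for y z u
    unfolding S_def
    using that good_c[OF that(1)] c
    by (intro green_mono good_src src_antimono) (auto intro: less_le_trans)
  have q0_green: "q0 u = green e (\<lambda>s. 0) u" for u by (simp add: green_def vol_def q0_def)
  have S_good: "good (S y)" if y: "good y" for y
    unfolding good_def
  proof (intro conjI ballI)
    show "continuous_on {0..U} (S y)"
      unfolding S_def by (rule DERIV_continuous_on[OF green_deriv[OF good_src[OF y]]])
    fix u assume u: "u \<in> {0..U}"
    show "q0 u \<le> S y u"
      unfolding q0_green S_def using u good_c[OF y] c
      by (intro green_mono good_src y src_nonneg) (auto intro: less_le_trans)
  qed
  define x where "x = (\<lambda>n. ((\<lambda>y. S (S y)) ^^ n) q0)"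
  have x_Suc: "x (Suc n) = S (S (x n))" for n by (simp add: x_def)
  have x_good: "good (x n)" for n
    by (induction n) (auto simp: x_Suc S_good, simp add: x_def good_q0)
  have x_inc: "x n u \<le> x (Suc n) u" if "u \<in> {0..U}" for n u
    using that
  proof (induction n arbitrary: u)
    case 0
    have "good (S (S q0))" by (intro S_good good_q0)
    then show ?case using 0 by (simp add: x_def good_def)
  next
    case (Suc n)
    have "S (S (x n)) u \<le> S (S (x (Suc n))) u"
      using Suc by (intro S_anti S_good x_good) auto
    then show ?case by (simp add: x_Suc)
  qed
  \<comment> \<open>Every iterate after the first is \<open>S\<close> of a function above
    \<open>q0\<close>, hence at most \<open>S q0\<close>; the maximum covers
    \<open>n = 0\<close>.\<close>
  define M where "M = (\<lambda>u. max (q0 u) (S q0 u))"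
  have x_bd: "x n u \<le> M u" if u: "u \<in> {0..U}" for n u
  proof (cases n)
    case 0
    then show ?thesis by (simp add: x_def M_def)
  next
    case (Suc m)
    have "S (S (x m)) u \<le> S q0 u"
      by (rule S_anti[OF good_q0 S_good[OF x_good] _ u]) (use S_good[OF x_good[of m]] in \<open>auto simp: good_def\<close>)
    then show ?thesis by (simp add: Suc x_Suc M_def)
  qed
  define p where "p = (\<lambda>u. lim (\<lambda>n. x n u))"
  have x_lim: "(\<lambda>n. x n u) \<longlonglongrightarrow> p u" if u: "u \<in> {0..U}" for u
  proof -
    have "incseq (\<lambda>n. x n u)" using x_inc[OF u] by (rule incseq_SucI)
    moreover have "\<forall>n. x n u \<le> M u" using x_bd[OF u] by simp
    ultimately show ?thesis unfolding p_def
      by (metis incseq_convergent limI)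
  qed
  \<comment> \<open>By \<open>green_0\<close> the slope of \<open>S y\<close> at 0 is
    \<open>S y 0 / V\<close>, so the bound \<open>S y 0 \<le> S q0 0\<close> yields a Lipschitz
    constant uniform over all good \<open>y\<close>.\<close>
  have vol_bd: "\<bar>(e + vol (src y) U) / (U + V)\<bar> \<le> \<bar>S y 0 / V\<bar>" for y
    using V_pos by (simp add: S_def green_0)
  define B where "B = S q0 0 / V"
  have S_lip: "\<bar>S y u - S y v\<bar> \<le> (B + U * (D_max / (2 * c))) * \<bar>u - v\<bar>"
    if y: "good y" and "u \<in> {0..U}" "v \<in> {0..U}" for y u v
  proof -
    have "0 \<in> {0..U}" using U_pos by simp
    then have "S y 0 \<le> S q0 0" "c \<le> S y 0"
      using S_anti[OF good_q0 y, of 0] y good_c[OF S_good[OF y], of 0] by (auto simp: good_def)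
    then have "\<bar>S y 0 / V\<bar> \<le> B" using c V_pos by (auto simp: B_def divide_right_mono)
    then have "\<bar>(e + vol (src y) U) / (U + V)\<bar> \<le> B" using vol_bd[of y] by linarith
    then have "(\<bar>(e + vol (src y) U) / (U + V)\<bar> + U * (D_max / (2 * c))) * \<bar>u - v\<bar>
      \<le> (B + U * (D_max / (2 * c))) * \<bar>u - v\<bar>" by (intro mult_right_mono add_right_mono) auto
    moreover have "\<bar>S y u - S y v\<bar>
      \<le> (\<bar>(e + vol (src y) U) / (U + V)\<bar> + U * (D_max / (2 * c))) * \<bar>u - v\<bar>"
      unfolding S_def by (rule green_src_lipschitz[OF c good_cont[OF y] good_c[OF y]]) (use that in auto)
    ultimately show ?thesis by linarith
  qed
  have S_lim: "(\<lambda>n. S (y n) u) \<longlonglongrightarrow> S z u"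
    if g: "\<And>n. good (y n)" and lim: "\<And>s. s \<in> {0..U} \<Longrightarrow> (\<lambda>n. y n s) \<longlonglongrightarrow> z s"
      and u: "u \<in> {0..U}" for y z u
  proof -
    have "(\<lambda>n. vol (src (y n)) v) \<longlonglongrightarrow> vol (src z) v" if "v \<in> {0..U}" for v
      by (rule vol_src_limit[OF order_refl c]) (use good_cont good_c that g lim in auto)
    then show ?thesis unfolding S_def green_def
      using u U_pos V_pos by (intro tendsto_intros) auto
  qed
  \<comment> \<open>The uniform Lipschitz bound is available for images under \<open>S\<close>,
    hence the limit along \<open>S (y n)\<close>. It makes the monotone limit \<open>p\<close>
    continuous.\<close>
  have limit_good: "good z" if g: "\<And>n. good (y n)" and "\<And>s. s \<in> {0..U} \<Longrightarrow> (\<lambda>n. S (y n) s) \<longlonglongrightarrow> z s" for y z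
    unfolding good_def
  proof (intro conjI ballI)
    show "continuous_on {0..U} z"
      by (rule continuous_on_lipschitz_limit[OF S_lip[OF g] that(2)])
    fix u assume u: "u \<in> {0..U}"
    show "q0 u \<le> z u"
      by (rule Lim_bounded2[OF that(2)[OF u], of 0]) (use S_good[OF g] u in \<open>auto simp: good_def\<close>)
  qed
  have xS_lim: "(\<lambda>n. S (S (x n)) u) \<longlonglongrightarrow> p u" if "u \<in> {0..U}" for u
    using LIMSEQ_Suc[OF x_lim[OF that]] by (simp add: x_Suc)
  have p_good: "good p" by (rule limit_good[OF S_good[OF x_good] xS_lim])
  have r_lim: "(\<lambda>n. S (x n) u) \<longlonglongrightarrow> S p u" if "u \<in> {0..U}" for u
    by (rule S_lim[OF x_good x_lim that])
  have r_good: "good (S p)" by (rule S_good[OF p_good])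
  \<comment> \<open>Only a fixed point of the square of \<open>S\<close> so far;
    \<open>p = S p\<close> still has to be shown.\<close>
  have p_eq: "p u = S (S p) u" if "u \<in> {0..U}" for u
    using LIMSEQ_unique[OF xS_lim[OF that] S_lim[OF S_good[OF x_good] r_lim that]] .
  define R where "R = S p"
  define P where "P = S R"
  define R' where "R' = (\<lambda>u. (e + vol (src p) U) / (U + V) - integral {0..u} (src p))"
  define P' where "P' = (\<lambda>u. (e + vol (src R) U) / (U + V) - integral {0..u} (src R))"
  have P_good: "good P" and R_good: "good R" using r_good S_good[OF r_good] by (auto simp: P_def R_def)
  have Pp: "P u = p u" if "u \<in> {0..U}" for u using p_eq[OF that] by (simp add: P_def R_def)
  have R_d: "(R has_real_derivative R' u) (at u within {0..U})" if "u \<in> {0..U}" for u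
    unfolding R_def S_def R'_def by (rule green_deriv[OF good_src[OF p_good] that])
  have P_d: "(P has_real_derivative P' u) (at u within {0..U})" if "u \<in> {0..U}" for u
    unfolding P_def P'_def unfolding S_def by (rule green_deriv[OF good_src[OF R_good] that])
  have R'_d: "(R' has_real_derivative - src p u) (at u within {0..U})" if "u \<in> {0..U}" for u
    unfolding R'_def
    by (rule derivative_eq_intros refl integral_has_real_derivative[OF good_src[OF p_good] that])+ simp
  have P'_d: "(P' has_real_derivative - src R u) (at u within {0..U})" if "u \<in> {0..U}" for u
    unfolding P'_def
    by (rule derivative_eq_intros refl integral_has_real_derivative[OF good_src[OF R_good] that])+ simp
  have pos: "P u > 0" "R u > 0" if "u \<in> {0..U}" for u
    using good_c[OF P_good that] good_c[OF R_good that] c by auto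
  \<comment> \<open>The Wronskian of \<open>R\<close> and \<open>P\<close>. Its derivative vanishes
    because \<open>src p * P\<close> and \<open>src R * R\<close> both equal \<open>D / 2\<close>,
    and at 0 the two Robin conditions make it zero.\<close>
  have W0: "R' u * P u - P' u * R u = 0" if u: "u \<in> {0..U}" for u
  proof -
    have "((\<lambda>u. R' u * P u - P' u * R u) has_real_derivative 0) (at u within {0..U})"
      if u: "u \<in> {0..U}" for u
    proof -
      have "((\<lambda>u. R' u * P u - P' u * R u) has_real_derivative
        (- src p u * P u + P' u * R' u - (- src R u * R u + R' u * P' u))) (at u within {0..U})"
        by (intro DERIV_diff DERIV_mult R_d P_d R'_d P'_d u)
      moreover have "src p u * P u = src R u * R u"
        using pos[OF u] Pp[OF u] by (simp add: src_def)
      ultimately show ?thesis by simp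
    qed
    then obtain k where k: "\<And>u. u \<in> {0..U} \<Longrightarrow> R' u * P u - P' u * R u = k"
      using has_field_derivative_zero_constant[of "{0..U}" "\<lambda>u. R' u * P u - P' u * R u"] by auto
    have "P 0 = V * P' 0" "R 0 = V * R' 0"
      by (simp_all add: P'_def R'_def P_def R_def S_def green_0)
    then have "k = 0" using k[of 0] U_pos by simp
    with k[OF u] show ?thesis by simp
  qed
  \<comment> \<open>A zero Wronskian makes \<open>R / P\<close> constant, and at \<open>U\<close>
    the quotient is \<open>e / e\<close>. Here \<open>e > 0\<close> is essential.\<close>
  have RP: "R u = P u" if u: "u \<in> {0..U}" for u
  proof -
    have "((\<lambda>u. R u / P u) has_real_derivative 0) (at u within {0..U})" if u: "u \<in> {0..U}" for u
    proof -
      have "((\<lambda>u. R u / P u) has_real_derivative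
        ((R' u * P u - R u * P' u) / (P u * P u))) (at u within {0..U})"
        by (intro DERIV_divide R_d P_d u) (use pos[OF u] in auto)
      then show ?thesis using W0[OF u] by (simp add: mult.commute)
    qed
    then obtain k where k: "\<And>u. u \<in> {0..U} \<Longrightarrow> R u / P u = k"
      using has_field_derivative_zero_constant[of "{0..U}" "\<lambda>u. R u / P u"] by auto
    have "P U = e" "R U = e" by (simp_all add: P_def R_def S_def)
    then have "k = 1" using k[of U] U_pos e by simp
    with k[OF u] pos[OF u] show ?thesis by simp
  qed
  have "profile e P P'"
    unfolding profile_def
  proof (intro conjI ballI)
    show "continuous_on {0..U} P" by (rule good_cont[OF P_good])
    have "continuous_on {0..U} P'" by (rule DERIV_continuous_on[OF P'_d])
    then show "continuous_on {0..<U} P'" by (rule continuous_on_subset) auto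
    fix u assume u: "u \<in> {0<..<U}"
    then have u': "u \<in> {0..U}" by auto
    show "(P has_real_derivative P' u) (at u)" using P_d[OF u'] u by (simp add: at_within_Icc_at)
    show "(P' has_real_derivative - D u / (2 * P u)) (at u)"
      using P'_d[OF u'] u RP[OF u'] by (simp add: at_within_Icc_at src_def)
  qed (use pos in \<open>auto simp: P_def P'_def S_def green_0\<close>)
  moreover have "P u = green e (src P) u" if "u \<in> {0..U}" for u
  proof -
    \<comment> \<open>\<open>P\<close> and \<open>R\<close> agree only on [0, U], so antitonicity in
      both directions replaces rewriting.\<close>
    have "S R u = S P u"
      using S_anti[OF P_good R_good _ that] S_anti[OF R_good P_good _ that] RP by force
    then show ?thesis by (simp add: P_def S_def)
  qed
  ultimately show ?thesis by blast
qed

subsection \<open>The limit \<open>e \<rightarrow> 0\<close>\<close>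

text \<open>Continuity is local: for \<open>b\<close> between \<open>x\<close> and \<open>U\<close>,
  the sets \<open>S\<close> and [0, b] coincide near \<open>x\<close>.\<close>

lemma continuous_within_from_subintervals:
  assumes f: "\<And>b. 0 < b \<Longrightarrow> b < U \<Longrightarrow> continuous_on {0..b} f"
    and S: "{0..<U} \<subseteq> S" "S \<subseteq> {0..}" and x: "x \<in> {0..<U}"
  shows "continuous (at x within S) f"
proof -
  define b where "b = (x + U) / 2"
  have b: "0 < b" "b < U" "x < b" using x by (auto simp: b_def)
  have "at x within S = at x within {0..b}"
  proof (rule at_within_nhd[of x "{..<b}"])
    show "S \<inter> {..<b} - {x} = {0..b} \<inter> {..<b} - {x}" using S b by auto
  qed (use b in auto)
  moreover have "continuous (at x within {0..b}) f"
    using f[OF b(1,2)] x b by (auto simp: continuous_on_eq_continuous_within)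
  ultimately show ?thesis by simp
qed

text \<open>This supplies the lower barrier for the limit e to 0: profiles below \<open>M\<close>
  have source at least \<open>src (\<lambda>_. M)\<close>. The integrand is continuous, nonnegative
  and positive at \<open>U/2\<close>.\<close>

lemma green_src_const_pos:
  assumes M: "M > 0" and u: "u \<in> {0..<U}"
  shows "green 0 (src (\<lambda>_. M)) u > 0"
proof -
  have c: "continuous_on {0..U} (src (\<lambda>_. M))"
    using M by (intro src_cont) auto
  have kc: "continuous_on {0..U} (\<lambda>s. ker u s * src (\<lambda>_. M) s)"
    by (intro continuous_intros ker_cont c)
  have nn: "0 \<le> ker u s * src (\<lambda>_. M) s" if "s \<in> {0..U}" for s
    using that u M by (intro mult_nonneg_nonneg ker_nonneg src_nonneg) auto
  have "0 < ker u (U/2) * src (\<lambda>_. M) (U/2)"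
    using u U_pos M D_pos[of "U/2"] by (intro mult_pos_pos ker_pos) (auto simp: src_def)
  then have "integral {0..U} (\<lambda>s. ker u s * src (\<lambda>_. M) s) \<noteq> 0"
    using U_pos by (subst integral_eq_0_iff[OF kc U_pos nn]) (auto intro!: bexI[of _ "U/2"])
  moreover have "0 \<le> integral {0..U} (\<lambda>s. ker u s * src (\<lambda>_. M) s)"
    by (rule integral_nonneg[OF integrable_continuous_real[OF kc] nn])
  ultimately show ?thesis using green_ker[OF c, of u 0] u by simp
qed

lemma ex_profile_zero: "\<exists>q p. profile 0 q p"
proof -
  have "\<forall>n. \<exists>q p. profile (inverse (real (Suc n))) q p
      \<and> (\<forall>u\<in>{0..U}. q u = green (inverse (real (Suc n))) (src q) u)"
    using ex_profile_pos by simp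
  then obtain q p where prof: "\<And>n. profile (inverse (real (Suc n))) (q n) (p n)"
    and fixp: "\<And>n u. u \<in> {0..U} \<Longrightarrow> q n u = green (inverse (real (Suc n))) (src (q n)) u"
    by metis
  have q_cont: "continuous_on {0..U} (q n)" for n using prof[of n] by (simp add: profile_def)
  have q_U: "q n U = inverse (real (Suc n))" for n using prof[of n] by (simp add: profile_def)
  have q_pos: "q n u > 0" if "u \<in> {0..U}" for n u
    using prof[of n] that q_U[of n] by (cases "u = U") (auto simp: profile_def)
  have q_dec: "q n u \<le> q m u" if "u \<in> {0..U}" "m \<le> n" for m n u
    by (rule profile_mono[OF prof prof _ that(1)]) (use that in \<open>auto simp: field_simps\<close>)
  obtain x where x: "x \<in> {0..U}" "\<And>u. u \<in> {0..U} \<Longrightarrow> q 0 u \<le> q 0 x"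
    using continuous_attains_sup[of "{0..U}" "q 0"] q_cont U_pos by auto
  \<comment> \<open>The maximum of the first profile bounds all later ones, since they decrease with
    \<open>n\<close>.\<close>
  define M where "M = q 0 x"
  have M: "M > 0" using q_pos[OF x(1)] by (simp add: M_def)
  have q_le: "q n u \<le> M" if "u \<in> {0..U}" for n u
    using q_dec[OF that, of 0 n] x(2)[OF that] by (simp add: M_def)
  define l where "l = green 0 (src (\<lambda>_. M))"
  have l_pos: "l u > 0" if "u \<in> {0..<U}" for u
    unfolding l_def by (rule green_src_const_pos[OF M that])
  have src_M_cont: "continuous_on {0..U} (src (\<lambda>_. M))" using M by (intro src_cont) auto
  have src_q_cont: "continuous_on {0..U} (src (q n))" for n
    by (rule src_cont[OF q_cont]) (use q_pos in auto)
  have l_cont: "continuous_on {0..U} l"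
    unfolding l_def by (rule DERIV_continuous_on[OF green_deriv[OF src_M_cont]])
  have l_le: "l u \<le> q n u" if u: "u \<in> {0..U}" for n u
    unfolding fixp[OF u] l_def
    using q_pos q_le u by (intro green_mono src_M_cont src_q_cont src_antimono) auto
  define Q where "Q = (\<lambda>u. lim (\<lambda>n. q n u))"
  have q_lim: "(\<lambda>n. q n u) \<longlonglongrightarrow> Q u" if u: "u \<in> {0..U}" for u
  proof -
    have "decseq (\<lambda>n. q n u)" using q_dec[OF u] by (auto simp: decseq_def)
    moreover have "\<forall>n. 0 \<le> q n u" using q_pos[OF u] less_imp_le by blast
    ultimately show ?thesis unfolding Q_def by (metis decseq_convergent limI)
  qed
  have Q_le: "Q u \<le> q n u" if u: "u \<in> {0..U}" for n u
    by (rule Lim_bounded[OF q_lim[OF u], of n]) (use q_dec[OF u] in auto)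
  have Q_ge: "l u \<le> Q u" if u: "u \<in> {0..U}" for u
    by (rule Lim_bounded2[OF q_lim[OF u], of 0]) (use l_le[OF u] in auto)
  have Q_pos: "Q u > 0" if "u \<in> {0..<U}" for u
    using l_pos[OF that] Q_ge[of u] that by auto
  have Q_U: "Q U = 0"
    using LIMSEQ_unique[OF q_lim[of U]] LIMSEQ_inverse_real_of_nat U_pos by (simp add: q_U)
  \<comment> \<open>With the slope at 0 written as \<open>q n 0 / V\<close>, the formula involves
    the source on [0, u] only, and the limit avoids the endpoint \<open>U\<close>, where the barrier
    \<open>l\<close> vanishes.\<close>
  have q_vol: "q n u = q n 0 / V * (u + V) - vol (src (q n)) u" if u: "u \<in> {0..U}" for n u
    using fixp[OF u, of n] fixp[of 0 n] V_pos U_pos by (simp add: green_0) (simp add: green_def)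
  have lower: "\<exists>c>0. \<forall>u\<in>{0..b}. c \<le> l u" if b: "0 < b" "b < U" for b
  proof -
    have "continuous_on {0..b} l" by (rule continuous_on_subset[OF l_cont]) (use b in auto)
    then obtain z where "z \<in> {0..b}" "\<And>u. u \<in> {0..b} \<Longrightarrow> l z \<le> l u"
      using continuous_attains_inf[of "{0..b}" l] b by auto
    then show ?thesis using l_pos[of z] b by auto
  qed
  have Q_cont_b: "continuous_on {0..b} Q" if b: "0 < b" "b < U" for b
  proof -
    obtain c where c: "c > 0" and "\<forall>u\<in>{0..b}. c \<le> l u" using lower[OF b] by blast
    then have qc: "c \<le> q n u" if "u \<in> {0..b}" for n u using l_le[of u n] that b by force
    have qb: "continuous_on {0..b} (q n)" for n
      by (rule continuous_on_subset[OF q_cont]) (use b in auto)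
    have sqb: "continuous_on {0..b} (src (q n))" for n
      by (rule continuous_on_subset[OF src_q_cont]) (use b in auto)
    have deriv: "(q n has_real_derivative (q n 0 / V - integral {0..z} (src (q n)))) (at z within {0..b})"
      if z: "z \<in> {0..b}" for n z
    proof -
      have "((\<lambda>u. q n 0 / V * (u + V) - vol (src (q n)) u) has_real_derivative
        (q n 0 / V - integral {0..z} (src (q n)))) (at z within {0..b})"
        by (rule affine_minus_vol_deriv[OF sqb z])
      then show ?thesis
        by (rule has_field_derivative_transform_within[of _ _ _ _ 1]) (use z b in \<open>auto simp del: times_divide_eq_left intro!: q_vol[symmetric]\<close>)
    qed
    have lip: "\<bar>q n u - q n v\<bar> \<le> (M / V + U * (D_max / (2 * c))) * \<bar>u - v\<bar>"
      if "u \<in> {0..b}" "v \<in> {0..b}" for n u v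
    proof -
      have "norm (q n u - q n v) \<le> (M / V + U * (D_max / (2 * c))) * norm (u - v)"
      proof (rule field_differentiable_bound[OF _ deriv _ that])
        fix z assume z: "z \<in> {0..b}"
        have "0 \<le> integral {0..z} (src (q n))"
          "integral {0..z} (src (q n)) \<le> U * (D_max / (2 * c))"
          using integral_src_le[OF c z _ qb qc] b by auto
        moreover have "0 \<le> q n 0 / V" "q n 0 / V \<le> M / V"
          using q_pos[of 0 n] q_le[of 0 n] U_pos V_pos by (auto simp: divide_right_mono)
        ultimately show "norm (q n 0 / V - integral {0..z} (src (q n))) \<le> M / V + U * (D_max / (2 * c))"
          unfolding real_norm_def by linarith
      qed auto
      then show ?thesis by simp
    qed
    show ?thesis by (rule continuous_on_lipschitz_limit[OF lip q_lim]) (use b in auto)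
  qed
  have Q_vol: "Q u = Q 0 / V * (u + V) - vol (src Q) u" if u: "u \<in> {0..<U}" for u
  proof -
    define b where "b = (u + U) / 2"
    have b: "0 < b" "b < U" "u < b" using u by (auto simp: b_def)
    obtain c where c: "c > 0" and "\<forall>u\<in>{0..b}. c \<le> l u" using lower[OF b(1,2)] by blast
    then have qc: "c \<le> q n u" if "u \<in> {0..b}" for n u using l_le[of u n] that b by force
    have qb: "continuous_on {0..b} (q n)" for n
      by (rule continuous_on_subset[OF q_cont]) (use b in auto)
    have "(\<lambda>n. vol (src (q n)) u) \<longlonglongrightarrow> vol (src Q) u"
      by (rule vol_src_limit[OF _ c qb qc q_lim]) (use b u in auto)
    then have "(\<lambda>n. q n 0 / V * (u + V) - vol (src (q n)) u) \<longlonglongrightarrow> Q 0 / V * (u + V) - vol (src Q) u"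
      using U_pos V_pos by (intro tendsto_intros q_lim) auto
    moreover have "(\<lambda>n. q n 0 / V * (u + V) - vol (src (q n)) u) = (\<lambda>n. q n u)"
      using u by (intro ext q_vol[symmetric]) auto
    ultimately show ?thesis using LIMSEQ_unique[OF q_lim[of u]] u by simp
  qed
  define P where "P = (\<lambda>u. Q 0 / V - integral {0..u} (src Q))"
  have src_Q_cont: "continuous_on {0..b} (src Q)" if b: "0 < b" "b < U" for b
    by (rule src_cont[OF Q_cont_b[OF b]]) (use Q_pos b in auto)
  have Q_d: "(Q has_real_derivative P u) (at u within {0..b})"
    if b: "0 < b" "b < U" and u: "u \<in> {0..b}" for b u
  proof -
    have "((\<lambda>u. Q 0 / V * (u + V) - vol (src Q) u) has_real_derivative P u) (at u within {0..b})"
      unfolding P_def by (rule affine_minus_vol_deriv[OF src_Q_cont[OF b] u])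
    then show ?thesis
      by (rule has_field_derivative_transform_within[of _ _ _ _ 1]) (use u b in \<open>auto simp del: times_divide_eq_left intro!: Q_vol[symmetric]\<close>)
  qed
  have P_d: "(P has_real_derivative - src Q u) (at u within {0..b})"
    if b: "0 < b" "b < U" and u: "u \<in> {0..b}" for b u
    unfolding P_def
    by (rule derivative_eq_intros refl integral_has_real_derivative[OF src_Q_cont[OF b] u])+ simp
  have "profile 0 Q P"
    unfolding profile_def
  proof (intro conjI ballI)
    show "continuous_on {0..U} Q"
      unfolding continuous_on_eq_continuous_within
    proof
      fix x assume x: "x \<in> {0..U}"
      show "continuous (at x within {0..U}) Q"
      proof (cases "x = U")
        case False
        with x show ?thesis by (intro continuous_within_from_subintervals Q_cont_b) auto
      next
        case True
        \<comment> \<open>The Lipschitz bounds are lost at \<open>U\<close>; instead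
          \<open>0 \<le> Q \<le> q n\<close> with \<open>q n U\<close> arbitrarily small squeezes
          \<open>Q\<close>.\<close>
        have "(Q \<longlongrightarrow> Q U) (at U within {0..U})"
        proof (rule tendstoI)
          fix e :: real assume "e > 0"
          then obtain n where n: "inverse (real (Suc n)) < e" using reals_Archimedean by blast
          have Q_nonneg: "0 \<le> Q x" if "x \<in> {0..U}" for x
            using Q_pos[of x] Q_U that by (cases "x = U") auto
          have "(q n \<longlongrightarrow> q n U) (at U within {0..U})"
            using q_cont[of n] U_pos by (auto simp: continuous_on_def)
          then have "\<forall>\<^sub>F x in at U within {0..U}. q n x < e"
            by (rule order_tendstoD) (simp add: q_U n del: of_nat_Suc)
          moreover have "\<forall>\<^sub>F x in at U within {0..U}. x \<in> {0..U}"
            by (auto simp: eventually_at_filter)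
          ultimately show "\<forall>\<^sub>F x in at U within {0..U}. dist (Q x) (Q U) < e"
            by eventually_elim (use Q_le[of _ n] Q_nonneg in \<open>force simp: Q_U dist_real_def\<close>)
        qed
        then show ?thesis by (simp add: True continuous_within)
      qed
    qed
    have "continuous_on {0..b} P" if "0 < b" "b < U" for b
      by (rule DERIV_continuous_on[OF P_d[OF that]])
    then show "continuous_on {0..<U} P"
      unfolding continuous_on_eq_continuous_within
      by (intro ballI continuous_within_from_subintervals)
        (auto simp: continuous_on_eq_continuous_within)
    fix u assume u: "u \<in> {0<..<U}"
    define b where "b = (u + U) / 2"
    have b: "0 < b" "b < U" "u < b" using u by (auto simp: b_def)
    show "(Q has_real_derivative P u) (at u)"
      using Q_d[OF b(1,2), of u] u b by (simp add: at_within_Icc_at)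
    show "(P has_real_derivative - D u / (2 * Q u)) (at u)"
      using P_d[OF b(1,2), of u] u b by (simp add: at_within_Icc_at src_def)
  qed (use Q_pos Q_U V_pos in \<open>auto simp: P_def\<close>)
  then show ?thesis by blast
qed

section \<open>Monotonicity of \<open>p\<close> and its divergence at \<open>U\<close>\<close>

lemma profile_deriv_strict_antimono:
  assumes "profile e q p" "0 \<le> u" "u < v" "v < U"
  shows "p v < p u"
proof (rule DERIV_neg_imp_decreasing_open[of u v p])
  show "continuous_on {u..v} p"
    using assms by (auto simp: profile_def elim!: continuous_on_subset)
  fix x assume x: "u < x" "x < v"
  then have "(p has_real_derivative - D x / (2 * q x)) (at x)" "q x > 0"
    using assms by (auto simp: profile_def)
  then show "\<exists>y. (p has_real_derivative y) (at x) \<and> y < 0"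
    using D_pos[of x] x assms by (intro exI[of _ "- D x / (2 * q x)"]) auto
qed fact

text \<open>If \<open>p\<close> were bounded below, \<open>q\<close> would vanish linearly at \<open>U\<close>, and then
  \<open>p' = - D / (2 q)\<close> would force a logarithmic divergence of \<open>p\<close>.\<close>

lemma profile_deriv_unbounded:
  assumes prof: "profile 0 q p"
  shows "\<exists>u\<in>{0<..<U}. p u < B"
proof (rule ccontr)
  assume "\<not> ?thesis"
  then have B: "B \<le> p u" if "u \<in> {0<..<U}" for u using that by force
  define K where "K = \<bar>B\<bar> + 1"
  have K: "K > 0" by (simp add: K_def)
  \<comment> \<open>Mean value theorem on [u, U], using \<open>q U = 0\<close> and
    \<open>p \<ge> - K\<close>.\<close>
  have q_le: "q u \<le> K * (U - u)" if u: "u \<in> {0<..<U}" for u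
  proof -
    have "continuous_on {u..U} q" using prof u by (auto simp: profile_def elim!: continuous_on_subset)
    moreover have q_d: "(q has_real_derivative p x) (at x)" if "u < x" "x < U" for x
      using prof u that by (auto simp: profile_def)
    then have "q differentiable (at x)" if "u < x" "x < U" for x
      using that real_differentiable_def by blast
    ultimately obtain y z where z: "u < z" "z < U" and "(q has_real_derivative y) (at z)"
      "q U - q u = (U - u) * y"
      using MVT[of u U q] u by auto
    then have z': "q U - q u = (U - u) * p z" using q_d[OF z] DERIV_unique by blast
    have "- K \<le> p z" using B[of z] z u by (auto simp: K_def)
    then have "(U - u) * (- K) \<le> (U - u) * p z" using u by (intro mult_left_mono) auto
    then show ?thesis using z' prof by (simp add: profile_def algebra_simps)
  qed
  obtain m where m: "m \<in> {U/2..U}" "\<And>u. u \<in> {U/2..U} \<Longrightarrow> D m \<le> D u"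
    using continuous_attains_inf[of "{U/2..U}" D] continuous_on_subset[OF D_cont, of "{U/2..U}"] U_pos
    by auto
  \<comment> \<open>With \<open>D \<ge> D m\<close> on [U/2, U) and the linear bound on
    \<open>q\<close>, the derivative of \<open>p\<close> is at most \<open>- c / (U - x)\<close>;
    hence \<open>g\<close> below is nonincreasing.\<close>
  define c where "c = D m / (2 * K)"
  have c: "c > 0" using D_pos[of m] m U_pos K by (simp add: c_def)
  define g where "g = (\<lambda>u. p u - c * ln (U - u))"
  have g_le: "g u \<le> g (U/2)" if u: "u \<in> {U/2..<U}" for u
  proof (rule DERIV_nonpos_imp_nonincreasing[of "U/2" u g])
    fix x assume x: "U/2 \<le> x" "x \<le> u"
    then have xI: "x \<in> {0<..<U}" using u U_pos by auto
    have p_d: "(p has_real_derivative - D x / (2 * q x)) (at x)"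
      using prof xI by (simp add: profile_def)
    have ln_d: "((\<lambda>u. ln (U - u)) has_real_derivative - 1 / (U - x)) (at x)"
      using xI by (auto intro!: derivative_eq_intros)
    have "(g has_real_derivative (- D x / (2 * q x) + c / (U - x))) (at x)"
      using DERIV_diff[OF p_d DERIV_cmult[OF ln_d, of c]] by (simp add: g_def)
    moreover have "c / (U - x) \<le> D x / (2 * q x)"
    proof -
      have "q x > 0" using prof xI by (simp add: profile_def)
      then have "D m / (2 * (K * (U - x))) \<le> D x / (2 * q x)"
        using m(2)[of x] q_le[OF xI] x xI D_nonneg[of m] m(1) U_pos D_nonneg[of x] by (intro frac_le) auto
      then show ?thesis by (simp add: c_def field_simps)
    qed
    ultimately show "\<exists>y. (g has_real_derivative y) (at x) \<and> y \<le> 0" by force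
  qed (use u in auto)
  \<comment> \<open>Small enough that \<open>c * ln d\<close> pushes \<open>p (U - d)\<close> down
    to at most \<open>B - 1\<close>.\<close>
  define d where "d = min (U/2) (exp ((B - g (U/2) - 1) / c))"
  have d: "0 < d" "d \<le> U/2" using U_pos by (auto simp: d_def)
  have "ln d \<le> ln (exp ((B - g (U/2) - 1) / c))" by (subst ln_le_cancel_iff) (use d in \<open>auto simp: d_def\<close>)
  then have "c * ln d \<le> B - g (U/2) - 1" using c by (simp add: field_simps)
  moreover have "p (U - d) - c * ln d \<le> g (U/2)" using g_le[of "U - d"] d by (simp add: g_def)
  moreover have "B \<le> p (U - d)" using B[of "U - d"] d U_pos by auto
  ultimately show False by linarith
qed

end

subsection \<open>Correspondence between profiles and solutions\<close>

locale stefan_problem =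
  fixes \<phi> :: "real \<Rightarrow> real" and U V :: real
  assumes adm: "admissible_phi \<phi>" and U_gt_0: "U > 0" and V_gt_0: "V > 0"
begin

lemma deriv_phi_DERIV: "(deriv \<phi> has_real_derivative deriv (deriv \<phi>) u) (at u)"
  using adm by (simp add: admissible_phi_def C2_on_def DERIV_deriv_iff_real_differentiable)

lemma deriv_phi_isCont: "isCont (deriv \<phi>) u"
  using deriv_phi_DERIV by (rule DERIV_isCont)

lemma deriv_phi_pos: "u > 0 \<Longrightarrow> deriv \<phi> u > 0"
  using adm strict_mono_onD[of "{0..}" "deriv \<phi>" 0 u] by (simp add: admissible_phi_def)

sublocale flux_problem "deriv \<phi>" U V
proof
  show "continuous_on {0..U} (deriv \<phi>)"
    by (intro continuous_at_imp_continuous_on ballI deriv_phi_isCont)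
  show "0 \<le> deriv \<phi> u" if "0 \<le> u" for u
    using deriv_phi_pos[of u] adm that by (cases "u = 0") (auto simp: admissible_phi_def)
qed (use U_gt_0 V_gt_0 deriv_phi_pos in auto)

text \<open>The solution is the inverse of \<open>2 * p\<close>, which maps (0, U) decreasingly onto
  the half-line below \<open>a\<close>; its flux is \<open>- q (f x)\<close>.\<close>

lemma profile_imp_solution:
  assumes prof: "profile 0 q p"
  shows "\<exists>f a. free_boundary_solution \<phi> U V f a"
proof -
  define a where "a = 2 * p 0"
  have q_pos: "q u > 0" if "u \<in> {0..<U}" for u using prof that by (simp add: profile_def)
  have q0: "q 0 = a * V / 2" using prof by (simp add: profile_def a_def)
  have a_pos: "a > 0" using q_pos[of 0] q0 U_pos V_pos by (simp add: zero_less_mult_iff)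
  have q_d: "(q has_real_derivative p u) (at u)" if "u \<in> {0<..<U}" for u
    using prof that by (simp add: profile_def)
  have p_d: "(p has_real_derivative - deriv \<phi> u / (2 * q u)) (at u)" if "u \<in> {0<..<U}" for u
    using prof that by (simp add: profile_def)
  have p_cont: "continuous_on {0..<U} p" using prof by (simp add: profile_def)
  have p_less: "p v < p u" if "0 \<le> u" "u < v" "v < U" for u v
    by (rule profile_deriv_strict_antimono[OF prof that])
  have p_less_iff: "p v < p u \<longleftrightarrow> u < v" if "u \<in> {0..<U}" "v \<in> {0..<U}" for u v
    using p_less[of u v] p_less[of v u] that by (cases u v rule: linorder_cases) auto
  \<comment> \<open>Intermediate value theorem between 0, where \<open>2 * p\<close> equals
    \<open>a\<close>, and a point supplied by the divergence of \<open>p\<close>.\<close>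
  have ex: "\<exists>u. u \<in> {0<..<U} \<and> 2 * p u = x" if x: "x < a" for x
  proof -
    obtain v where v: "v \<in> {0<..<U}" "p v < x / 2" using profile_deriv_unbounded[OF prof] by blast
    have "continuous_on {0..v} p" by (rule continuous_on_subset[OF p_cont]) (use v in auto)
    then obtain u where u: "0 \<le> u" "u \<le> v" "p u = x / 2"
      using IVT2'[of p v "x / 2" 0] v x by (auto simp: a_def)
    moreover have "u \<noteq> 0" using u x by (auto simp: a_def)
    ultimately show ?thesis using v by (intro exI[of _ u]) auto
  qed
  \<comment> \<open>The value \<open>undefined\<close> at \<open>a\<close> is the one that
    \<open>extensional\<close> prescribes.\<close>
  define f where "f = (\<lambda>x. if x < a then SOME u. u \<in> {0<..<U} \<and> 2 * p u = x
    else if x = a then undefined else - V)"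
  have f_in: "f x \<in> {0<..<U}" and p_f: "2 * p (f x) = x" if "x < a" for x
    using someI_ex[OF ex[OF that]] that by (auto simp: f_def)
  have p_lt_a: "2 * p u < a" if "u \<in> {0<..<U}" for u
    using p_less[of 0 u] that by (simp add: a_def)
  have f_p: "f (2 * p u) = u" if u: "u \<in> {0<..<U}" for u
    using p_less_iff[of u "f (2 * p u)"] p_less_iff[of "f (2 * p u)" u]
      f_in[OF p_lt_a[OF u]] p_f[OF p_lt_a[OF u]] u
    by (cases u "f (2 * p u)" rule: linorder_cases) auto
  have f_isCont: "isCont f x" if x: "x < a" for x
  proof -
    have "isCont f (2 * p (f x))"
    proof (rule isCont_inverse_function2[where f = "\<lambda>u. 2 * p u" and x = "f x" and a = "f x / 2" and b = "(f x + U) / 2"])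
      fix z assume "f x / 2 \<le> z" "z \<le> (f x + U) / 2"
      then have z: "z \<in> {0<..<U}" using f_in[OF x] by auto
      show "f (2 * p z) = z" by (rule f_p[OF z])
      show "isCont (\<lambda>u. 2 * p u) z" by (intro continuous_intros DERIV_isCont[OF p_d[OF z]])
    qed (use f_in[OF x] in auto)
    then show ?thesis by (simp add: p_f[OF x])
  qed
  \<comment> \<open>The reciprocal of the derivative \<open>- deriv \<phi> u / q u\<close> of
    \<open>2 * p\<close>, taken at \<open>u = f x\<close>.\<close>
  define f' where "f' = (\<lambda>x. - q (f x) / deriv \<phi> (f x))"
  have f_d: "(f has_real_derivative f' x) (at x)" if x: "x < a" for x
  proof -
    have pos: "q (f x) > 0" "deriv \<phi> (f x) > 0" using f_in[OF x] q_pos deriv_phi_pos by auto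
    have "(f has_real_derivative inverse (2 * (- deriv \<phi> (f x) / (2 * q (f x))))) (at x)"
    proof (rule DERIV_inverse_function[where f = "\<lambda>u. 2 * p u" and a = "x - 1" and b = a])
      show "((\<lambda>u. 2 * p u) has_real_derivative 2 * (- deriv \<phi> (f x) / (2 * q (f x)))) (at (f x))"
        by (rule DERIV_cmult[OF p_d[OF f_in[OF x]]])
    qed (use x pos p_f f_isCont[OF x] in auto)
    moreover have "inverse (2 * (- deriv \<phi> (f x) / (2 * q (f x)))) = f' x"
      using pos by (simp add: f'_def field_simps)
    ultimately show ?thesis by simp
  qed
  have deriv_f: "deriv f x = f' x" if "x < a" for x using f_d[OF that] by (rule DERIV_imp_deriv)
  have q_f_d: "((\<lambda>x. q (f x)) has_real_derivative p (f x) * f' x) (at x)" if x: "x < a" for x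
    by (rule DERIV_chain2[OF q_d[OF f_in[OF x]] f_d[OF x]])
  have phi_f_d: "((\<lambda>x. deriv \<phi> (f x)) has_real_derivative deriv (deriv \<phi>) (f x) * f' x) (at x)"
    if x: "x < a" for x
    by (rule DERIV_chain2[OF deriv_phi_DERIV f_d[OF x]])
  define f'' where "f'' = (\<lambda>x. - ((p (f x) * f' x * deriv \<phi> (f x)
      - q (f x) * (deriv (deriv \<phi>) (f x) * f' x)) / (deriv \<phi> (f x) * deriv \<phi> (f x))))"
  have f'_d: "(f' has_real_derivative f'' x) (at x)" if x: "x < a" for x
  proof -
    have "((\<lambda>x. - (q (f x) / deriv \<phi> (f x))) has_real_derivative f'' x) (at x)"
      unfolding f''_def
      by (intro DERIV_minus DERIV_divide q_f_d[OF x] phi_f_d[OF x])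
        (use deriv_phi_pos[of "f x"] f_in[OF x] in auto)
    then show ?thesis by (simp add: f'_def)
  qed
  have deriv_f_d: "(deriv f has_real_derivative f'' x) (at x)" if x: "x < a" for x
    by (rule has_field_derivative_transform_within_open[OF f'_d[OF x], of "{..<a}"])
      (use x deriv_f in auto)
  have left: "\<forall>\<^sub>F x in at_left a. x < a" by (simp add: eventually_at_filter)
  \<comment> \<open>Approach from above is recorded because \<open>q\<close> is continuous at 0 only
    from the right.\<close>
  have f_lim: "filterlim f (at_right 0) (at_left a)"
    unfolding filterlim_at
  proof (intro conjI)
    show "(f \<longlongrightarrow> 0) (at_left a)"
    proof (rule tendstoI)
      fix e :: real assume e: "e > 0"
      define u where "u = min e (U/2)"
      have u: "u \<in> {0<..<U}" using e U_pos by (auto simp: u_def)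
      have "dist (f x) 0 < e" if x: "2 * p u < x" "x < a" for x
      proof -
        have "p u < p (f x)" using p_f[OF x(2)] x by simp
        then have "f x < u" using p_less_iff[of "f x" u] f_in[OF x(2)] u by auto
        then show ?thesis using f_in[OF x(2)] by (simp add: u_def dist_real_def)
      qed
      then show "\<forall>\<^sub>F x in at_left a. dist (f x) 0 < e"
        using p_lt_a[OF u] by (auto simp: eventually_at_left)
    qed
    show "\<forall>\<^sub>F x in at_left a. f x \<in> {0<..} \<and> f x \<noteq> 0"
      by (rule eventually_mono[OF left]) (use f_in in force)
  qed
  have "free_boundary_solution \<phi> U V f a"
    unfolding free_boundary_solution_def
  proof (intro conjI allI impI)
    show "a > 0" by (rule a_pos)
    show "f \<in> extensional (UNIV - {a})" by (simp add: extensional_def f_def)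
    show "C2_on {..<a} f"
      unfolding C2_on_def
    proof (intro conjI ballI)
      fix x assume "x \<in> {..<a}"
      then have x: "x < a" by simp
      show "f differentiable (at x)" "deriv f differentiable (at x)"
        using f_d[OF x] deriv_f_d[OF x] real_differentiable_def by blast+
    next
      have "continuous (at x within {..<a}) f''" if x: "x < a" for x
      proof -
        have "isCont (\<lambda>x. p (f x)) x"
          by (rule isCont_o2[OF f_isCont[OF x] DERIV_isCont[OF p_d[OF f_in[OF x]]]])
        moreover have "isCont (\<lambda>x. deriv (deriv \<phi>) (f x)) x"
        proof (rule isCont_o2[OF f_isCont[OF x]])
          show "isCont (deriv (deriv \<phi>)) (f x)"
            using adm by (simp add: admissible_phi_def C2_on_def continuous_on_eq_continuous_at)
        qed
        ultimately have "isCont f'' x"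
          unfolding f''_def
          by (intro continuous_intros DERIV_isCont[OF q_f_d[OF x]] DERIV_isCont[OF phi_f_d[OF x]]
              DERIV_isCont[OF f'_d[OF x]]) (use deriv_phi_pos[of "f x"] f_in[OF x] in auto)
        then show ?thesis by (rule continuous_at_imp_continuous_at_within)
      qed
      then have "continuous_on {..<a} f''" by (simp add: continuous_on_eq_continuous_within)
      then show "continuous_on {..<a} (deriv (deriv f))"
        by (rule continuous_on_eq) (use DERIV_imp_deriv[OF deriv_f_d] in auto)
    qed
    show "f x > 0" if "x < a" for x using f_in[OF that] by simp
    show "f x = - V" if "x > a" for x using that by (simp add: f_def)
    have flux: "deriv \<phi> (f x) * deriv f x = - q (f x)" if "x < a" for x
      using deriv_f[OF that] deriv_phi_pos[of "f x"] f_in[OF that] by (simp add: f'_def)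
    show "- (1 / 2) * x * deriv f x = deriv (\<lambda>x. deriv \<phi> (f x) * deriv f x) x" if x: "x < a" for x
    proof -
      \<comment> \<open>The flux is \<open>- q (f x)\<close> and \<open>q\<close> has derivative
        \<open>p\<close>; then \<open>p (f x) = x / 2\<close> is exactly the equation.\<close>
      have "((\<lambda>x. deriv \<phi> (f x) * deriv f x) has_real_derivative - (p (f x) * f' x)) (at x)"
        by (rule has_field_derivative_transform_within_open[OF DERIV_minus[OF q_f_d[OF x]], of "{..<a}"])
          (use x flux in auto)
      then show ?thesis using p_f[OF x] deriv_f[OF x] by (simp add: DERIV_imp_deriv)
    qed
    show "(f \<longlongrightarrow> U) at_bot"
    proof (rule tendstoI)
      fix e :: real assume e: "e > 0"
      define u where "u = max (U - e) (U/2)"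
      have u: "u \<in> {0<..<U}" using e U_pos by (auto simp: u_def)
      have "dist (f x) U < e" if x: "x < 2 * p u" for x
      proof -
        have x': "x < a" using x p_lt_a[OF u] by simp
        have "p (f x) < p u" using p_f[OF x'] x by simp
        then have "u < f x" using p_less_iff[of u "f x"] f_in[OF x'] u by auto
        then show ?thesis using f_in[OF x'] by (simp add: u_def dist_real_def)
      qed
      then show "\<forall>\<^sub>F x in at_bot. dist (f x) U < e"
        by (auto simp: eventually_at_bot_dense)
    qed
    show "(f \<longlongrightarrow> 0) (at_left a)" using f_lim by (auto simp: filterlim_at)
    have "continuous_on {0..U} q" using prof by (simp add: profile_def)
    then have "(q \<longlongrightarrow> q 0) (at 0 within {0..U})"
      using U_pos by (auto simp: continuous_on_def)
    then have "(q \<longlongrightarrow> q 0) (at_right 0)" 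
      using U_pos by (simp add: at_within_Icc_at_right)
    then have "((\<lambda>x. - q (f x)) \<longlongrightarrow> - q 0) (at_left a)"
      by (intro tendsto_minus) (rule filterlim_compose[OF _ f_lim])
    moreover have "\<forall>\<^sub>F x in at_left a. - q (f x) = deriv \<phi> (f x) * deriv f x"
      by (rule eventually_mono[OF left]) (use flux in simp)
    ultimately have "((\<lambda>x. deriv \<phi> (f x) * deriv f x) \<longlongrightarrow> - q 0) (at_left a)"
      by (rule Lim_transform_eventually)
    then show "((\<lambda>x. deriv \<phi> (f x) * deriv f x) \<longlongrightarrow> - (a * V / 2)) (at_left a)"
      by (simp add: q0)
  qed
  then show ?thesis by blast
qed

text \<open>The flux \<open>w\<close> satisfies the linear equation w' = k w, so it cannot change
  sign, and the free boundary condition makes it negative near \<open>a\<close>.\<close>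

lemma solution_decreasing:
  assumes sol: "free_boundary_solution \<phi> U V f a" and x: "x < a"
  shows "deriv f x < 0"
proof -
  have f_d: "(f has_real_derivative deriv f y) (at y)"
    and f'_d: "(deriv f has_real_derivative deriv (deriv f) y) (at y)" if "y < a" for y
    using sol that by (auto simp: free_boundary_solution_def C2_on_def DERIV_deriv_iff_real_differentiable)
  have phi_pos: "deriv \<phi> (f y) > 0" if "y < a" for y
    using sol that by (intro deriv_phi_pos) (simp add: free_boundary_solution_def)
  have phi_f_d: "((\<lambda>y. deriv \<phi> (f y)) has_real_derivative deriv (deriv \<phi>) (f y) * deriv f y) (at y)"
    if "y < a" for y
    by (rule DERIV_chain2[OF deriv_phi_DERIV f_d[OF that]])
  define w where "w = (\<lambda>y. deriv \<phi> (f y) * deriv f y)"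
  define k where "k = (\<lambda>y. - y / (2 * deriv \<phi> (f y)))"
  have w_d: "(w has_real_derivative k y * w y) (at y)" if y: "y < a" for y
  proof -
    have "(w has_real_derivative deriv w y) (at y)"
      \<comment> \<open>The product rule only certifies differentiability; the value of the
        derivative comes from the equation.\<close>
      unfolding w_def by (rule DERIV_imp_deriv[THEN ssubst]) (rule DERIV_mult[OF phi_f_d[OF y] f'_d[OF y]])+
    moreover have "deriv w y = k y * w y"
      using sol y phi_pos[OF y] by (simp add: free_boundary_solution_def w_def k_def)
    ultimately show ?thesis by simp
  qed
  have "(w \<longlongrightarrow> - (a * V / 2)) (at_left a)"
    using sol by (simp add: free_boundary_solution_def w_def)
  moreover have "- (a * V / 2) < 0" using sol V_pos by (simp add: free_boundary_solution_def)
  ultimately have "\<forall>\<^sub>F y in at_left a. w y < 0" by (rule order_tendstoD)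
  moreover have "\<forall>\<^sub>F y in at_left a. y \<in> {x<..<a}" by (rule eventually_at_left_real[OF x])
  ultimately have "\<exists>b. w b < 0 \<and> b \<in> {x<..<a}"
    by (intro eventually_happens'[OF trivial_limit_at_left_real] eventually_conj)
  then obtain b where b: "w b < 0" "x < b" "b < a" by auto
  \<comment> \<open>Exponent of the integrating factor, normalised to vanish at \<open>x\<close>, so
    that \<open>w x = w b * exp (- K b)\<close>.\<close>
  define K where "K = (\<lambda>y. integral {x..y} k)"
  have "isCont k y" if "y \<in> {x..b}" for y
    unfolding k_def using b that phi_pos[of y]
    by (intro continuous_intros DERIV_isCont[OF phi_f_d]) auto
  then have "continuous_on {x..b} k" by (simp add: continuous_at_imp_continuous_on)
  then have K_d: "(K has_real_derivative k y) (at y within {x..b})" if "y \<in> {x..b}" for y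
    unfolding K_def using that by (rule integral_has_real_derivative)
  have "((\<lambda>y. w y * exp (- K y)) has_real_derivative 0) (at y within {x..b})" if y: "y \<in> {x..b}" for y
  proof -
    have wy: "(w has_real_derivative k y * w y) (at y within {x..b})"
      using w_d[of y] y b by (auto intro: has_field_derivative_at_within)
    have "((\<lambda>y. w y * exp (- K y)) has_real_derivative
        k y * w y * exp (- K y) + exp (- K y) * - k y * w y) (at y within {x..b})"
      by (intro DERIV_mult wy DERIV_chain'[OF DERIV_minus[OF K_d[OF y]] DERIV_exp])
    then show ?thesis by (simp add: algebra_simps)
  qed
  then obtain c where "\<And>y. y \<in> {x..b} \<Longrightarrow> w y * exp (- K y) = c"
    using has_field_derivative_zero_constant[of "{x..b}" "\<lambda>y. w y * exp (- K y)"] by auto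
  from this[of x] this[of b] b have "w x = w b * exp (- K b)" by (simp add: K_def)
  then have "w x < 0" using b by (simp add: mult_neg_pos)
  then show ?thesis using phi_pos[OF x] by (simp add: w_def mult_less_0_iff)
qed

text \<open>With \<open>g\<close> the inverse of \<open>f\<close>, take \<open>p = g / 2\<close> and
  let \<open>q\<close> be minus the flux along \<open>g\<close>. The delicate point is
  \<open>q\<close> tending to 0 at \<open>U\<close>, as no condition on the flux at minus infinity
  is given.\<close>

lemma solution_imp_profile:
  assumes sol: "free_boundary_solution \<phi> U V f a"
  shows "\<exists>q p. profile 0 q p \<and> a = 2 * p 0 \<and> (\<forall>x<a. f x \<in> {0<..<U} \<and> x = 2 * p (f x))"
proof -
  have a_pos: "a > 0" using sol by (simp add: free_boundary_solution_def)
  have f_d: "(f has_real_derivative deriv f x) (at x)"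
    and f'_d: "(deriv f has_real_derivative deriv (deriv f) x) (at x)" if "x < a" for x
    using sol that by (auto simp: free_boundary_solution_def C2_on_def DERIV_deriv_iff_real_differentiable)
  have f_pos: "f x > 0" if "x < a" for x using sol that by (simp add: free_boundary_solution_def)
  have f_bot: "(f \<longlongrightarrow> U) at_bot" and f_left: "(f \<longlongrightarrow> 0) (at_left a)"
    using sol by (auto simp: free_boundary_solution_def)
  have f_less: "f y < f x" if "x < y" "y < a" for x y
  proof (rule DERIV_neg_imp_decreasing[of x y f])
    fix z assume "x \<le> z" "z \<le> y"
    then show "\<exists>d. (f has_real_derivative d) (at z) \<and> d < 0"
      using f_d[of z] solution_decreasing[OF sol, of z] that by auto
  qed (use that in auto)
  \<comment> \<open>The limit at minus infinity gives only a weak bound; moving from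
    \<open>x - 1\<close> to \<open>x\<close> makes it strict.\<close>
  have f_less_U: "f x < U" if x: "x < a" for x
  proof -
    have "\<forall>\<^sub>F y in at_bot. f (x - 1) \<le> f y"
      unfolding eventually_at_bot_dense using f_less[of _ "x - 1"] x by (intro exI[of _ "x - 1"]) (auto intro: less_imp_le)
    then have "f (x - 1) \<le> U" by (rule tendsto_lowerbound[OF f_bot]) simp
    moreover have "f x < f (x - 1)" using x by (intro f_less) auto
    ultimately show ?thesis by simp
  qed
  have f_in: "f x \<in> {0<..<U}" if "x < a" for x using f_pos[OF that] f_less_U[OF that] by simp
  have f_isCont: "isCont f x" if "x < a" for x by (rule DERIV_isCont[OF f_d[OF that]])
  have surj: "\<exists>x. x < a \<and> f x = u" if u: "u \<in> {0<..<U}" for u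
  proof -
    have "\<forall>\<^sub>F y in at_bot. u < f y" using f_bot u by (intro order_tendstoD(1)[of f U]) auto
    then obtain N where N: "\<And>y. y < N \<Longrightarrow> u < f y" by (auto simp: eventually_at_bot_dense)
    have "\<forall>\<^sub>F y in at_left a. f y < u" using f_left u by (intro order_tendstoD(2)[of f 0]) auto
    moreover have "\<forall>\<^sub>F y in at_left a. y \<in> {min N a - 1<..<a}" by (rule eventually_at_left_real) simp
    ultimately have "\<exists>z. f z < u \<and> z \<in> {min N a - 1<..<a}"
      by (intro eventually_happens'[OF trivial_limit_at_left_real] eventually_conj)
    then obtain z where z: "f z < u" "min N a - 1 < z" "z < a" by auto
    have "continuous_on {min N a - 1..z} f"
      using z by (intro continuous_at_imp_continuous_on ballI f_isCont) auto
    moreover have "u < f (min N a - 1)" by (rule N) auto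
    ultimately obtain x where "x \<le> z" "f x = u"
      using IVT2'[of f z u "min N a - 1"] z by auto
    then show ?thesis using z by (intro exI[of _ x]) auto
  qed
  define g where "g = (\<lambda>u. SOME x. x < a \<and> f x = u)"
  have g_less: "g u < a" and f_g: "f (g u) = u" if "u \<in> {0<..<U}" for u
    using someI_ex[OF surj[OF that]] by (auto simp: g_def)
  have g_f: "g (f x) = x" if x: "x < a" for x
    using f_less[of x "g (f x)"] f_less[of "g (f x)" x] f_g[OF f_in[OF x]] g_less[OF f_in[OF x]] x
    by (cases x "g (f x)" rule: linorder_cases) auto
  have g_antimono: "g v < g u" if "u \<in> {0<..<U}" "v \<in> {0<..<U}" "u < v" for u v
    using f_less[of "g u" "g v"] g_less[OF that(1)] g_less[OF that(2)] f_g[OF that(1)] f_g[OF that(2)] that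
    by (cases "g u" "g v" rule: linorder_cases) auto
  have g_isCont: "isCont g u" if u: "u \<in> {0<..<U}" for u
  proof -
    have "isCont g (f (g u))"
    proof (rule isCont_inverse_function2[where f = f and x = "g u" and a = "g u - 1" and b = "(g u + a) / 2"])
      fix z assume "g u - 1 \<le> z" "z \<le> (g u + a) / 2"
      then have "z < a" using g_less[OF u] by auto
      then show "g (f z) = z" "isCont f z" using g_f f_isCont by auto
    qed (use g_less[OF u] in auto)
    then show ?thesis by (simp add: f_g[OF u])
  qed
  have g_d: "(g has_real_derivative inverse (deriv f (g u))) (at u)" if u: "u \<in> {0<..<U}" for u
  proof (rule DERIV_inverse_function[where f = f and a = 0 and b = U])
    show "deriv f (g u) \<noteq> 0" using solution_decreasing[OF sol g_less[OF u]] by simp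
  qed (use u f_d[OF g_less[OF u]] f_g g_isCont[OF u] in auto)
  define w where "w = (\<lambda>x. deriv \<phi> (f x) * deriv f x)"
  have w_d: "(w has_real_derivative - (1/2) * x * deriv f x) (at x)" if x: "x < a" for x
  proof -
    have "(w has_real_derivative deriv w x) (at x)"
      unfolding w_def
      by (rule DERIV_imp_deriv[THEN ssubst])
        (rule DERIV_mult[OF DERIV_chain2[OF deriv_phi_DERIV f_d[OF x]] f'_d[OF x]])+
    then show ?thesis using sol x by (simp add: free_boundary_solution_def w_def)
  qed
  define p where "p = (\<lambda>u. if u = 0 then a / 2 else g u / 2)"
  \<comment> \<open>The values at 0 and \<open>U\<close> are the boundary data; continuity there is
    proved afterwards.\<close>
  define q where "q = (\<lambda>u. if u = 0 then a * V / 2 else if u = U then 0 else - w (g u))"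
  have q_pos: "q u > 0" if "u \<in> {0..<U}" for u
  proof (cases "u = 0")
    case True
    then show ?thesis using a_pos V_pos by (simp add: q_def)
  next
    case False
    then have u: "u \<in> {0<..<U}" using that by auto
    have "w (g u) < 0" using solution_decreasing[OF sol g_less[OF u]] deriv_phi_pos[of "f (g u)"] f_pos[OF g_less[OF u]]
      by (simp add: w_def mult_pos_neg)
    then show ?thesis using u by (simp add: q_def)
  qed
  have p_d: "(p has_real_derivative - deriv \<phi> u / (2 * q u)) (at u)" if u: "u \<in> {0<..<U}" for u
  proof -
    have "((\<lambda>u. g u / 2) has_real_derivative inverse (deriv f (g u)) / 2) (at u)"
      by (intro DERIV_cdivide g_d u)
    then have "(p has_real_derivative inverse (deriv f (g u)) / 2) (at u)"
      by (rule has_field_derivative_transform_within_open[where S = "{0<..<U}"]) (use u in \<open>auto simp: p_def\<close>)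
    moreover have "inverse (deriv f (g u)) / 2 = - deriv \<phi> u / (2 * q u)"
      using u f_g[OF u] deriv_phi_pos[of u] solution_decreasing[OF sol g_less[OF u]]
      by (simp add: q_def w_def field_simps)
    ultimately show ?thesis by simp
  qed
  have q_d: "(q has_real_derivative p u) (at u)" if u: "u \<in> {0<..<U}" for u
  proof -
    have "((\<lambda>u. - w (g u)) has_real_derivative
        - (- (1/2) * g u * deriv f (g u) * inverse (deriv f (g u)))) (at u)"
      by (intro DERIV_minus DERIV_chain2[OF w_d[OF g_less[OF u]] g_d[OF u]])
    moreover have "- (- (1/2) * g u * deriv f (g u) * inverse (deriv f (g u))) = p u"
      using u solution_decreasing[OF sol g_less[OF u]] by (simp add: p_def)
    ultimately have "((\<lambda>u. - w (g u)) has_real_derivative p u) (at u)" by simp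
    then show ?thesis
      by (rule has_field_derivative_transform_within_open[where S = "{0<..<U}"]) (use u in \<open>auto simp: q_def\<close>)
  qed
  have near_0: "\<forall>\<^sub>F u in at_right 0. u \<in> {0<..<U}" by (rule eventually_at_right_real[OF U_pos])
  have g_lim: "filterlim g (at_left a) (at_right 0)"
    unfolding filterlim_at
  proof (intro conjI)
    show "\<forall>\<^sub>F u in at_right 0. g u \<in> {..<a} \<and> g u \<noteq> a"
      by (rule eventually_mono[OF near_0]) (use g_less in force)
    show "(g \<longlongrightarrow> a) (at_right 0)"
    proof (rule tendstoI)
      fix e :: real assume e: "e > 0"
      have ae: "a - e < a" using e by simp
      have "\<forall>\<^sub>F u in at_right 0. u \<in> {0<..<f (a - e)}"
        by (rule eventually_at_right_real[OF f_pos[OF ae]])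
      then show "\<forall>\<^sub>F u in at_right 0. dist (g u) a < e"
      proof eventually_elim
        case (elim u)
        have u: "u \<in> {0<..<U}" using elim f_less_U[OF ae] by auto
        have "g (f (a - e)) < g u" by (rule g_antimono[OF u f_in[OF ae]]) (use elim in simp)
        then show ?case using g_f[OF ae] g_less[OF u] by (simp add: dist_real_def)
      qed
    qed
  qed
  have right_eq: "at 0 within {0..U} = at_right 0" "at 0 within {0..<U} = at_right 0"
    using U_pos by (auto simp: at_within_Icc_at_right intro!: at_within_nhd[of 0 "{..<U}"])
  have "((\<lambda>u. g u / 2) \<longlongrightarrow> a / 2) (at_right 0)"
    using g_lim by (intro tendsto_divide tendsto_const) (auto simp: filterlim_at)
  moreover have "\<forall>\<^sub>F u in at_right 0. g u / 2 = p u"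
    by (rule eventually_mono[OF near_0]) (simp add: p_def)
  ultimately have p_lim0: "(p \<longlongrightarrow> p 0) (at_right 0)"
    using Lim_transform_eventually by (force simp: p_def)
  have "(w \<longlongrightarrow> - (a * V / 2)) (at_left a)"
    using sol by (simp add: free_boundary_solution_def w_def)
  then have "((\<lambda>u. - w (g u)) \<longlongrightarrow> - (- (a * V / 2))) (at_right 0)"
    by (intro tendsto_minus) (rule filterlim_compose[OF _ g_lim])
  moreover have "\<forall>\<^sub>F u in at_right 0. - w (g u) = q u"
    by (rule eventually_mono[OF near_0]) (simp add: q_def)
  ultimately have q_lim0: "(q \<longlongrightarrow> q 0) (at_right 0)"
    using Lim_transform_eventually by (force simp: q_def)
  have p_f: "p (f x) = x / 2" if "x < a" for x using f_pos[OF that] g_f[OF that] by (simp add: p_def)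
  \<comment> \<open>Beyond \<open>u0\<close> the position is negative, so \<open>p < 0\<close> and
    \<open>q\<close> decreases towards \<open>U\<close>.\<close>
  define u0 where "u0 = f (-1)"
  have u0: "u0 \<in> {0<..<U}" using f_in[of "-1"] a_pos by (simp add: u0_def)
  have p_neg: "p u < 0" if "u0 \<le> u" "u < U" for u
    using g_antimono[of u0 u] g_f[of "-1"] a_pos that u0 by (cases "u = u0") (auto simp: p_def u0_def)
  have q_decr: "q v \<le> q u" if "u0 \<le> u" "u \<le> v" "v < U" for u v
  proof (rule DERIV_nonpos_imp_nonincreasing[of u v q])
    fix x assume "u \<le> x" "x \<le> v"
    then show "\<exists>y. (q has_real_derivative y) (at x) \<and> y \<le> 0"
      using q_d[of x] p_neg[of x] that u0 by (intro exI[of _ "p x"]) auto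
  qed (use that in auto)
  \<comment> \<open>If \<open>q\<close> stayed above \<open>e\<close>, then
    \<open>p' \<ge> - C\<close> would bound \<open>p\<close> below near \<open>U\<close>, although
    \<open>p (f x) = x / 2\<close> is unbounded below.\<close>
  have q_small: "\<exists>u. u0 \<le> u \<and> u < U \<and> q u < e" if e: "e > 0" for e
  proof (rule ccontr)
    assume "\<not> ?thesis"
    then have q_ge: "e \<le> q u" if "u0 \<le> u" "u < U" for u using that by force
    define C where "C = D_max / (2 * e)"
    have p_ge: "p u0 + C * u0 \<le> p u + C * u" if u: "u0 \<le> u" "u < U" for u
    proof (rule DERIV_nonneg_imp_nondecreasing[of u0 u "\<lambda>u. p u + C * u"])
      fix x assume x: "u0 \<le> x" "x \<le> u"
      then have xI: "x \<in> {0<..<U}" using u0 u by auto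
      have "((\<lambda>u. p u + C * u) has_real_derivative (- deriv \<phi> x / (2 * q x) + C * 1)) (at x)"
        by (intro DERIV_add p_d[OF xI] DERIV_cmult DERIV_ident)
      moreover have "deriv \<phi> x / (2 * q x) \<le> C"
        using src_le[of e q x] e q_ge[of x] x xI u by (simp add: src_def C_def)
      ultimately show "\<exists>y. ((\<lambda>u. p u + C * u) has_real_derivative y) (at x) \<and> 0 \<le> y" by force
    qed (use u in auto)
    have C: "C \<ge> 0" using D_le_max[of U] D_pos[of U] U_pos e by (simp add: C_def)
    \<comment> \<open>The first entry forces \<open>f x \<ge> u0\<close>, the second puts
      \<open>p (f x)\<close> below the bound from \<open>p_ge\<close> by 1.\<close>
    define x where "x = min (-1) (2 * (p u0 + C * u0 - C * U - 1))"
    have x: "x < a" using a_pos by (simp add: x_def)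
    have "x \<le> -1" by (simp add: x_def)
    then have "u0 \<le> f x" using f_less[of x "-1"] a_pos by (cases "x = -1") (auto simp: u0_def)
    then have "p u0 + C * u0 \<le> p (f x) + C * f x" using p_ge[of "f x"] f_in[OF x] by simp
    moreover have "C * f x \<le> C * U" using f_less_U[OF x] C by (intro mult_left_mono) auto
    moreover have "p (f x) \<le> p u0 + C * u0 - C * U - 1" unfolding p_f[OF x] by (simp add: x_def)
    ultimately show False by linarith
  qed
  have q_limU: "(q \<longlongrightarrow> q U) (at U within {0..U})"
  proof -
    have "(q \<longlongrightarrow> q U) (at_left U)"
    proof (rule tendstoI)
      fix e :: real assume e: "e > 0"
      obtain u where u: "u0 \<le> u" "u < U" "q u < e" using q_small[OF e] by blast
      have "\<forall>\<^sub>F v in at_left U. v \<in> {u<..<U}" by (rule eventually_at_left_real[OF u(2)])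
      then show "\<forall>\<^sub>F v in at_left U. dist (q v) (q U) < e"
      proof eventually_elim
        case (elim v)
        then have "q v \<le> q u" "0 < q v" using q_decr[of u v] q_pos[of v] u u0 by auto
        moreover have "q U = 0" using U_pos by (simp add: q_def)
        ultimately show ?case using u by (simp add: dist_real_def)
      qed
    qed
    then show ?thesis using U_pos by (simp add: at_within_Icc_at_left)
  qed
  have "profile 0 q p"
    unfolding profile_def
  proof (intro conjI ballI)
    show "continuous_on {0..U} q"
      unfolding continuous_on_def
    proof
      fix x assume x: "x \<in> {0..U}"
      consider "x = 0" | "x = U" | "x \<in> {0<..<U}" using x by force
      then show "(q \<longlongrightarrow> q x) (at x within {0..U})"
      proof cases
        case 3
        then show ?thesis
          using DERIV_isCont[OF q_d[OF 3]] by (auto simp: isCont_def intro: tendsto_within_subset)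
      qed (use q_lim0 q_limU right_eq in auto)
    qed
    show "continuous_on {0..<U} p"
      unfolding continuous_on_def
    proof
      fix x assume x: "x \<in> {0..<U}"
      consider "x = 0" | "x \<in> {0<..<U}" using x by force
      then show "(p \<longlongrightarrow> p x) (at x within {0..<U})"
      proof cases
        case 2
        then show ?thesis
          using DERIV_isCont[OF p_d[OF 2]] by (auto simp: isCont_def intro: tendsto_within_subset)
      qed (use p_lim0 right_eq in auto)
    qed
  qed (use q_pos q_d p_d U_pos in \<open>auto simp: q_def p_def\<close>)
  moreover have "a = 2 * p 0" by (simp add: p_def)
  moreover have "f x \<in> {0<..<U} \<and> x = 2 * p (f x)" if "x < a" for x
    using f_in[OF that] p_f[OF that] by simp
  ultimately show ?thesis by blast
qed

text \<open>Both solutions yield the same profile, hence the same \<open>a\<close>; injectivity of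
  \<open>p\<close> identifies them to the left of \<open>a\<close>, and extensionality at
  \<open>a\<close> itself.\<close>

lemma solution_unique:
  assumes 1: "free_boundary_solution \<phi> U V f a" and 2: "free_boundary_solution \<phi> U V g b"
  shows "f = g \<and> a = b"
proof -
  obtain q p where P: "profile 0 q p" "a = 2 * p 0"
    "\<And>x. x < a \<Longrightarrow> f x \<in> {0<..<U} \<and> x = 2 * p (f x)"
    using solution_imp_profile[OF 1] by auto
  obtain r s where R: "profile 0 r s" "b = 2 * s 0"
    "\<And>x. x < b \<Longrightarrow> g x \<in> {0<..<U} \<and> x = 2 * s (g x)"
    using solution_imp_profile[OF 2] by auto
  have ps: "p u = s u" if "u \<in> {0..<U}" for u
    by (rule profile_unique(2)[OF P(1) R(1) that])
  have ab: "a = b" using P(2) R(2) ps[of 0] U_pos by simp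
  have "f x = g x" for x
  proof (cases x a rule: linorder_cases)
    case less
    then have "p (f x) = p (g x)" "f x \<in> {0<..<U}" "g x \<in> {0<..<U}"
      using P(3)[of x] R(3)[of x] ps[of "g x"] ab by auto
    then show ?thesis
      using profile_deriv_strict_antimono[OF P(1), of "f x" "g x"]
        profile_deriv_strict_antimono[OF P(1), of "g x" "f x"]
      by (cases "f x" "g x" rule: linorder_cases) auto
  next
    case equal
    have "f a = undefined" "g b = undefined"
      using 1 2 extensional_arb[of f "UNIV - {a}" a] extensional_arb[of g "UNIV - {b}" b]
      by (auto simp: free_boundary_solution_def)
    then show ?thesis using ab equal by simp
  next
    case greater
    then show ?thesis using 1 2 ab by (simp add: free_boundary_solution_def)
  qed
  with ab show ?thesis by auto
qed

end

theorem theorem5p20: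
  fixes \<phi> :: "real \<Rightarrow> real" and U\<^sub>0 V\<^sub>0 :: real
  assumes "admissible_phi \<phi>" and "U\<^sub>0 > 0" and "V\<^sub>0 > 0"
  shows "\<exists>!(f, a). free_boundary_solution \<phi> U\<^sub>0 V\<^sub>0 f a"
proof -
  interpret stefan_problem \<phi> U\<^sub>0 V\<^sub>0 using assms by unfold_locales
  obtain q p where "profile 0 q p" using ex_profile_zero by blast
  then obtain f a where "free_boundary_solution \<phi> U\<^sub>0 V\<^sub>0 f a"
    using profile_imp_solution by blast
  then show ?thesis using solution_unique by (intro ex1I[of _ "(f, a)"]) auto
qed

end
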